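(* Let $p$ be an odd prime, $\alpha,\beta\in\mathbb Z_p$ and $z\in\mathbb Z_p^\times$ with $z-1$ prime to $p$. Suppose that (i) $\langle-\alpha\rangle_p\leq \langle-\beta\rangle_p$; (ii) $p+\langle-\alpha\rangle_p>2\langle-\beta\rangle_p$; (iii) $(\alpha-\beta+1)_{p-1}\not\equiv0\pmod{p^2}$. Then $$ {}_3F_2\bigg[\begin{matrix}\alpha&\alpha&\beta\\&1&\alpha-\beta+1\end{matrix}\bigg|\,z\bigg]_{p-1}+(-z)^{1-\lambda_p(\alpha)}{}_3F_2\bigg[\begin{matrix}\alpha&\alpha&\beta\\&1&\alpha-\beta+1\end{matrix}\bigg|\,\frac{1}{z}\bigg]_{p-1} \equiv(1-z)^{1-\lambda_p(\alpha)}{}_3F_2\bigg[\begin{matrix}1-\beta&\frac12\alpha&\frac12\alpha+\frac12\\&1&\alpha-\beta+1\end{matrix}\bigg|\,-\frac{4z}{(1-z)^2}\bigg]_{p-1}\pmod{p^2}. $$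
   Context: $\mathbb Z_p$ denotes the $p$-adic integers and $\mathbb Z_p^\times$ its units. For $\alpha\in\mathbb Z_p$, $\langle\alpha\rangle_p$ is the unique integer in $\{0,1,\ldots,p-1\}$ congruent to $\alpha$ modulo $p$, and $\lambda_p(\alpha):=-\langle-\alpha\rangle_p+\frac{\alpha+\langle-\alpha\rangle_p}{p}\cdot(p-1)$. For $a\in\mathbb Z$, $s\in\mathbb Z_p$ and $w\in\mathbb Z_p^\times$, the power $w^{a+s(p-1)}$ is defined as $w^{a}\sum_{k=0}^\infty\binom{s}{k}(w^{p-1}-1)^k$ (this is well defined); in particular $w^{1-\lambda_p(\alpha)}$ is defined for $w\in\mathbb Z_p^\times$. Pochhammer symbol: $(x)_0=1$, $(x)_k=x(x+1)\cdots(x+k-1)$. For $n\ge 0$, ${}_{3}F_2\Big[\begin{matrix}\alpha_0&\alpha_1&\alpha_2\\&\beta_1&\beta_2\end{matrix}\Big|\,z\Big]_n=\sum_{k=0}^{n}\frac{(\alpha_0)_k(\alpha_1)_k(\alpha_2)_k}{(\beta_1)_k(\beta_2)_k}\cdot\frac{z^k}{k!}$. For $x,y\in\mathbb Q_p$, $x\equiv y\pmod{p^2}$ means $x-y\in p^2\mathbb Z_p$. *)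

theory Defs
  imports
    "HOL-Analysis.Analysis"
    "HOL-Computational_Algebra.Computational_Algebra"
    "HOL-Library.Product_Plus"
    "Berlekamp_Zassenhaus.Finite_Field"
begin

section \<open>The ring of p-adic integers\<close>

text \<open>
  The prime is the cardinality of the type argument.  A p-adic integer is a coherent sequence
  of residues: its \<open>n\<close>-th entry is the canonical representative modulo \<open>p ^ n\<close>.
\<close>

typedef 'p padic_int =
  "{x :: nat \<Rightarrow> int. \<forall>n. x (Suc n) mod int CARD('p::prime_card) ^ n = x n}"
  by (rule exI[of _ "\<lambda>_. 0"]) simp

setup_lifting type_definition_padic_int

lemma CARD_prime_card_gt_1: "int CARD('p::prime_card) > 1"
  using prime_gt_1_nat[OF prime_card[where 'a = 'p]] by simp

lemma padic_coherent_mod: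
  assumes "\<forall>n. x (Suc n) mod int CARD('p::prime_card) ^ n = x n" and "m \<le> n"
  shows "x n mod int CARD('p) ^ m = x m"
  using assms(2)
proof (induction n rule: dec_induct)
  case base
  have "x m = x (Suc m) mod int CARD('p) ^ m" using assms(1) by simp
  then show ?case by (metis mod_mod_trivial)
next
  case (step n)
  have "x (Suc n) mod int CARD('p) ^ m = (x (Suc n) mod int CARD('p) ^ n) mod int CARD('p) ^ m"
    using step.hyps by (simp add: mod_mod_cancel le_imp_power_dvd)
  then show ?case using assms(1) step.IH by simp
qed

lemma Rep_padic_int_mod:
  "m \<le> n \<Longrightarrow> Rep_padic_int (x :: 'p::prime_card padic_int) n mod int CARD('p) ^ m = Rep_padic_int x m"
  using Rep_padic_int[of x] by (intro padic_coherent_mod) auto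

lemma padic_int_eqI:
  "(\<And>n. Rep_padic_int x n = Rep_padic_int y n) \<Longrightarrow> x = (y :: 'p::prime_card padic_int)"
  by (simp add: Rep_padic_int_inject[symmetric] fun_eq_iff)

lemma mod_pow_Suc_cancel: "(a mod (q::int) ^ Suc n) mod q ^ n = a mod q ^ n"
  by (simp add: mod_mod_cancel le_imp_power_dvd)

instantiation padic_int :: (prime_card) comm_ring_1
begin

lift_definition zero_padic_int :: "'a padic_int" is "\<lambda>_. 0" by simp

lift_definition one_padic_int :: "'a padic_int" is "\<lambda>n. 1 mod int CARD('a) ^ n"
  by (auto simp only: mod_pow_Suc_cancel)

lift_definition plus_padic_int :: "'a padic_int \<Rightarrow> 'a padic_int \<Rightarrow> 'a padic_int"
  is "\<lambda>x y n. (x n + y n) mod int CARD('a) ^ n"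
  by (simp only: mod_pow_Suc_cancel) (metis mod_add_eq)

lift_definition minus_padic_int :: "'a padic_int \<Rightarrow> 'a padic_int \<Rightarrow> 'a padic_int"
  is "\<lambda>x y n. (x n - y n) mod int CARD('a) ^ n"
  by (simp only: mod_pow_Suc_cancel) (metis mod_diff_eq)

lift_definition uminus_padic_int :: "'a padic_int \<Rightarrow> 'a padic_int"
  is "\<lambda>x n. (- x n) mod int CARD('a) ^ n"
  by (simp only: mod_pow_Suc_cancel) (metis mod_minus_eq)

lift_definition times_padic_int :: "'a padic_int \<Rightarrow> 'a padic_int \<Rightarrow> 'a padic_int"
  is "\<lambda>x y n. (x n * y n) mod int CARD('a) ^ n"
  by (simp only: mod_pow_Suc_cancel) (metis mod_mult_eq)

instance
proof
  fix a b c :: "'a padic_int"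
  show "a + b + c = a + (b + c)" by transfer (simp add: mod_simps algebra_simps)
  show "a + b = b + a" by transfer (simp add: algebra_simps)
  show "0 + a = a" by (rule padic_int_eqI) (simp add: plus_padic_int.rep_eq zero_padic_int.rep_eq Rep_padic_int_mod)
  show "- a + a = 0" by transfer (simp add: mod_simps)
  show "a - b = a + - b" by transfer (simp add: mod_simps)
  show "a * b * c = a * (b * c)" by transfer (simp add: mod_simps algebra_simps)
  show "a * b = b * a" by transfer (simp add: algebra_simps)
  show "1 * a = a"
    by (rule padic_int_eqI)
       (simp add: times_padic_int.rep_eq one_padic_int.rep_eq Rep_padic_int_mod mod_mult_left_eq)
  show "(a + b) * c = a * c + b * c" by transfer (simp add: mod_simps algebra_simps)
  have "Rep_padic_int (0 :: 'a padic_int) 1 \<noteq> Rep_padic_int 1 1"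
    using CARD_prime_card_gt_1[where 'p = 'a]
    by (simp add: zero_padic_int.rep_eq one_padic_int.rep_eq)
  then show "(0 :: 'a padic_int) \<noteq> 1" by metis
qed

end

lemma Rep_padic_int_of_nat:
  "Rep_padic_int (of_nat k :: 'p::prime_card padic_int) n = int k mod int CARD('p) ^ n"
  by (induction k)
     (simp_all add: zero_padic_int.rep_eq one_padic_int.rep_eq plus_padic_int.rep_eq mod_simps)

instance padic_int :: (prime_card) ring_char_0
proof
  show "inj (of_nat :: nat \<Rightarrow> 'a padic_int)"
  proof (rule injI)
    fix m n :: nat
    assume eq: "(of_nat m :: 'a padic_int) = of_nat n"
    define k where "k = m + n"
    have "CARD('a) \<ge> 2" using CARD_prime_card_gt_1[where 'p = 'a] by simp
    then have "k < CARD('a) ^ k" using less_exp[of k] power_mono[of 2 "CARD('a)" k] by linarith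
    then have "int m < int CARD('a) ^ k" "int n < int CARD('a) ^ k"
      unfolding k_def of_nat_power[symmetric] by linarith+
    then show "m = n"
      using arg_cong[OF eq, of "\<lambda>x. Rep_padic_int x k"] by (simp add: Rep_padic_int_of_nat)
  qed
qed

lemma padic_int_shift:
  fixes x :: "'p::prime_card padic_int"
  assumes "Rep_padic_int x k = 0"
  shows "\<exists>u. x = of_nat CARD('p) ^ k * u \<and> (\<forall>m. Rep_padic_int u m = Rep_padic_int x (m + k) div int CARD('p) ^ k)"
proof -
  let ?p = "int CARD('p)"
  let ?r = "Rep_padic_int x"
  define f where "f = (\<lambda>m. ?r (m + k) div ?p ^ k)"
  have f: "f \<in> {x. \<forall>n. x (Suc n) mod ?p ^ n = x n}"
  proof (rule CollectI, rule allI)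
    fix n
    have pos: "?p ^ k > 0" using CARD_prime_card_gt_1[where 'p = 'p] by simp
    have "?r (n + k) = ?r (Suc n + k) mod ?p ^ (n + k)" by (simp add: Rep_padic_int_mod)
    also have "\<dots> = ?r (Suc n + k) mod (?p ^ k * ?p ^ n)" by (simp add: power_add mult.commute)
    also have "\<dots> = ?p ^ k * (?r (Suc n + k) div ?p ^ k mod ?p ^ n) + ?r (Suc n + k) mod ?p ^ k"
      using CARD_prime_card_gt_1[where 'p = 'p] by (intro zmod_zmult2_eq) simp
    finally have "?r (n + k) = ?p ^ k * (?r (Suc n + k) div ?p ^ k mod ?p ^ n) + ?r (Suc n + k) mod ?p ^ k" .
    moreover have "?r (Suc n + k) mod ?p ^ k = 0" by (subst Rep_padic_int_mod) (auto simp: assms)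
    ultimately show "f (Suc n) mod ?p ^ n = f n" using pos unfolding f_def by simp
  qed
  define u where "u = (Abs_padic_int f :: 'p padic_int)"
  have u: "Rep_padic_int u m = f m" for m using f by (simp add: u_def Abs_padic_int_inverse)
  have "x = of_nat CARD('p) ^ k * u"
  proof (rule padic_int_eqI)
    fix m
    have "?p ^ k dvd ?r (m + k)"
      using Rep_padic_int_mod[of k "m + k" x] assms by (simp add: dvd_eq_mod_eq_0)
    then have "(?p ^ k * f m) mod ?p ^ m = ?r m" by (simp add: f_def Rep_padic_int_mod)
    then show "?r m = Rep_padic_int (of_nat CARD('p) ^ k * u) m"
      unfolding of_nat_power[symmetric] times_padic_int.rep_eq Rep_padic_int_of_nat u
      by (simp add: mod_simps)
  qed
  then show ?thesis using u by (auto simp: f_def)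
qed

lemma padic_int_decompose:
  fixes x :: "'p::prime_card padic_int"
  assumes "x \<noteq> 0"
  shows "\<exists>k u. x = of_nat CARD('p) ^ k * u \<and> Rep_padic_int u 1 \<noteq> 0"
proof -
  let ?r = "Rep_padic_int x"
  let ?p = "int CARD('p)"
  obtain n where n: "?r n \<noteq> 0"
    using assms padic_int_eqI[of x 0] by (auto simp: zero_padic_int.rep_eq)
  define N where "N = (LEAST n. ?r n \<noteq> 0)"
  have N: "?r N \<noteq> 0" unfolding N_def using n by (rule LeastI)
  have "?r 0 = 0" using Rep_padic_int_mod[of 0 0 x] by simp
  with N obtain k where k: "N = Suc k" by (cases N) auto
  have "?r k = 0" using not_less_Least[of k "\<lambda>n. ?r n \<noteq> 0"] k unfolding N_def by auto
  from padic_int_shift[OF this] obtain u where u: "x = of_nat CARD('p) ^ k * u"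
    "\<forall>m. Rep_padic_int u m = ?r (m + k) div ?p ^ k" by blast
  have "?p ^ k dvd ?r N"
    using Rep_padic_int_mod[of k N x] k \<open>?r k = 0\<close> by (simp add: dvd_eq_mod_eq_0)
  then have "?r N div ?p ^ k \<noteq> 0" using N by (auto simp: dvd_div_eq_0_iff)
  then have "Rep_padic_int u 1 \<noteq> 0" using u(2) k by simp
  with u(1) show ?thesis by blast
qed

lemma padic_int_not_dvd:
  fixes u :: "'p::prime_card padic_int"
  assumes "Rep_padic_int u 1 \<noteq> 0" and "n \<ge> 1"
  shows "\<not> int CARD('p) dvd Rep_padic_int u n"
  using Rep_padic_int_mod[of 1 n u] assms by (auto simp: dvd_eq_mod_eq_0)

instance padic_int :: (prime_card) idom
proof
  fix x y :: "'a padic_int"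
  assume "x \<noteq> 0" "y \<noteq> 0"
  let ?p = "int CARD('a)"
  from padic_int_decompose[OF \<open>x \<noteq> 0\<close>] obtain a u
    where x: "x = of_nat CARD('a) ^ a * u" and u: "Rep_padic_int u 1 \<noteq> 0" by blast
  from padic_int_decompose[OF \<open>y \<noteq> 0\<close>] obtain b v
    where y: "y = of_nat CARD('a) ^ b * v" and v: "Rep_padic_int v 1 \<noteq> 0" by blast
  define n where "n = Suc (a + b)"
  have xy: "x * y = of_nat (CARD('a) ^ (a + b)) * (u * v)"
    unfolding x y by (simp add: power_add mult_ac)
  have "Rep_padic_int (x * y) n = (?p ^ (a + b) * (Rep_padic_int u n * Rep_padic_int v n)) mod ?p ^ n"
    unfolding xy times_padic_int.rep_eq Rep_padic_int_of_nat by (simp add: mod_simps)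
  moreover have "\<not> ?p ^ n dvd ?p ^ (a + b) * (Rep_padic_int u n * Rep_padic_int v n)"
  proof
    assume "?p ^ n dvd ?p ^ (a + b) * (Rep_padic_int u n * Rep_padic_int v n)"
    then have "?p ^ (a + b) * ?p dvd ?p ^ (a + b) * (Rep_padic_int u n * Rep_padic_int v n)"
      by (simp add: n_def mult.commute)
    then have "?p dvd Rep_padic_int u n * Rep_padic_int v n"
      using CARD_prime_card_gt_1[where 'p = 'a] by (subst (asm) dvd_mult_cancel_left) simp
    then have "?p dvd Rep_padic_int u n \<or> ?p dvd Rep_padic_int v n"
      using prime_card_int[where 'a = 'a] by (simp add: prime_dvd_mult_iff)
    then show False using padic_int_not_dvd[OF u, of n] padic_int_not_dvd[OF v, of n] by (simp add: n_def)
  qed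
  ultimately have "Rep_padic_int (x * y) n \<noteq> 0" by (simp add: dvd_eq_mod_eq_0)
  then show "x * y \<noteq> 0" by (metis zero_padic_int.rep_eq)
qed

lemma padic_int_unit:
  fixes u :: "'p::prime_card padic_int"
  assumes "Rep_padic_int u 1 \<noteq> 0"
  shows "\<exists>v. u * v = 1"
proof -
  let ?p = "int CARD('p)"
  let ?r = "Rep_padic_int u"
  have cop: "coprime (?r n) (?p ^ n)" for n
  proof (cases "n = 0")
    case False
    then have "coprime ?p (?r n)"
      using padic_int_not_dvd[OF assms, of n] prime_card_int[where 'a = 'p]
      by (intro prime_imp_coprime) auto
    then show ?thesis by (simp add: coprime_commute)
  qed auto
  have "\<exists>y. [?r n * y = 1] (mod ?p ^ n)" for n
    using cong_solve_coprime_int[OF cop[of n]] by blast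
  then obtain f where f: "\<And>n. [?r n * f n = 1] (mod ?p ^ n)" by metis
  define g where "g = (\<lambda>n. f n mod ?p ^ n)"
  have g: "g \<in> {x. \<forall>n. x (Suc n) mod ?p ^ n = x n}"
  proof (rule CollectI, rule allI)
    fix n
    have "[?r (Suc n) * f (Suc n) = 1] (mod ?p ^ n)"
      using f[of "Suc n"] by (rule cong_dvd_modulus) simp
    moreover have "[?r (Suc n) = ?r n] (mod ?p ^ n)"
      unfolding cong_def by (simp add: Rep_padic_int_mod)
    ultimately have "[?r n * f (Suc n) = ?r n * f n] (mod ?p ^ n)"
      using f[of n] by (meson cong_mult cong_refl cong_sym cong_trans)
    then have "[f (Suc n) = f n] (mod ?p ^ n)" using cop[of n] by (simp add: cong_mult_lcancel)
    then show "g (Suc n) mod ?p ^ n = g n"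
      unfolding g_def by (simp only: mod_pow_Suc_cancel) (simp add: cong_def)
  qed
  define v where "v = (Abs_padic_int g :: 'p padic_int)"
  have v: "Rep_padic_int v n = g n" for n using g by (simp add: v_def Abs_padic_int_inverse)
  have "u * v = 1"
  proof (rule padic_int_eqI)
    fix n
    have "(?r n * g n) mod ?p ^ n = 1 mod ?p ^ n"
      using f[of n] by (simp add: g_def cong_def mod_simps)
    then show "Rep_padic_int (u * v) n = Rep_padic_int (1 :: 'p padic_int) n"
      by (simp add: times_padic_int.rep_eq one_padic_int.rep_eq v)
  qed
  then show ?thesis by blast
qed


section \<open>The field of p-adic numbers\<close>

text \<open>
  The fraction field of the p-adic integers, as a type constructor of its own so that it can be
  given the p-adic metric.
\<close>

typedef 'p padic = "UNIV :: 'p::prime_card padic_int fract set" ..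

setup_lifting type_definition_padic

instantiation padic :: (prime_card) field
begin

lift_definition zero_padic :: "'a padic" is 0 .
lift_definition one_padic :: "'a padic" is 1 .
lift_definition plus_padic :: "'a padic \<Rightarrow> 'a padic \<Rightarrow> 'a padic" is "(+)" .
lift_definition minus_padic :: "'a padic \<Rightarrow> 'a padic \<Rightarrow> 'a padic" is "(-)" .
lift_definition uminus_padic :: "'a padic \<Rightarrow> 'a padic" is uminus .
lift_definition times_padic :: "'a padic \<Rightarrow> 'a padic \<Rightarrow> 'a padic" is "(*)" .
lift_definition inverse_padic :: "'a padic \<Rightarrow> 'a padic" is inverse .
lift_definition divide_padic :: "'a padic \<Rightarrow> 'a padic \<Rightarrow> 'a padic" is "(/)" .

instance
  by standard (transfer; simp add: algebra_simps divide_inverse)+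

end

definition of_padic_int :: "'p::prime_card padic_int \<Rightarrow> 'p padic" where
  "of_padic_int x = Abs_padic (to_fract x)"

lemma Rep_of_padic_int: "Rep_padic (of_padic_int x) = to_fract x"
  by (simp add: of_padic_int_def Abs_padic_inverse)

lemma of_padic_int_0 [simp]: "of_padic_int 0 = 0"
  by (simp add: Rep_padic_inject[symmetric] Rep_of_padic_int zero_padic.rep_eq)

lemma of_padic_int_1 [simp]: "of_padic_int 1 = 1"
  by (simp add: Rep_padic_inject[symmetric] Rep_of_padic_int one_padic.rep_eq)

lemma of_padic_int_add [simp]: "of_padic_int (x + y) = of_padic_int x + of_padic_int y"
  by (simp add: Rep_padic_inject[symmetric] Rep_of_padic_int plus_padic.rep_eq)

lemma of_padic_int_uminus [simp]: "of_padic_int (- x) = - of_padic_int x"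
  by (simp add: Rep_padic_inject[symmetric] Rep_of_padic_int uminus_padic.rep_eq)

lemma of_padic_int_diff [simp]: "of_padic_int (x - y) = of_padic_int x - of_padic_int y"
  by (simp add: Rep_padic_inject[symmetric] Rep_of_padic_int minus_padic.rep_eq)

lemma of_padic_int_mult [simp]: "of_padic_int (x * y) = of_padic_int x * of_padic_int y"
  by (simp add: Rep_padic_inject[symmetric] Rep_of_padic_int times_padic.rep_eq)

lemma of_padic_int_eq_iff [simp]: "of_padic_int x = of_padic_int y \<longleftrightarrow> x = y"
  by (simp add: Rep_padic_inject[symmetric] Rep_of_padic_int)

lemma of_padic_int_of_nat [simp]: "of_padic_int (of_nat n) = of_nat n"
  by (induction n) simp_all

lemma of_padic_int_power [simp]: "of_padic_int (x ^ n) = of_padic_int x ^ n"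
  by (induction n) simp_all

instance padic :: (prime_card) field_char_0
proof
  show "inj (of_nat :: nat \<Rightarrow> 'a padic)"
    by (rule injI) (metis of_padic_int_of_nat of_padic_int_eq_iff of_nat_eq_iff)
qed

lemma padic_quotient: "\<exists>a b. b \<noteq> 0 \<and> x = of_padic_int a / of_padic_int b"
proof -
  obtain a b where "Rep_padic x = Fract a b" "b \<noteq> 0" by (cases "Rep_padic x") auto
  then have "x = of_padic_int a / of_padic_int b"
    by (simp add: Rep_padic_inject[symmetric] Rep_of_padic_int divide_padic.rep_eq Fract_conv_to_fract)
  with \<open>b \<noteq> 0\<close> show ?thesis by blast
qed

definition padic_Ints :: "'p::prime_card padic set" where
  "padic_Ints = range of_padic_int"

definition padic_units :: "'p::prime_card padic set" where
  "padic_units = {x \<in> padic_Ints. \<exists>y\<in>padic_Ints. x * y = 1}"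

text \<open>Congruence modulo \<open>p ^ n\<close> in the field of p-adic numbers.\<close>

definition padic_cong :: "nat \<Rightarrow> 'p::prime_card padic \<Rightarrow> 'p padic \<Rightarrow> bool" where
  "padic_cong n x y \<longleftrightarrow> (\<exists>t\<in>padic_Ints. x - y = of_nat CARD('p) ^ n * t)"

lemma padic_Ints_0 [simp]: "0 \<in> padic_Ints"
  unfolding padic_Ints_def by (metis of_padic_int_0 rangeI)

lemma padic_Ints_add: "x \<in> padic_Ints \<Longrightarrow> y \<in> padic_Ints \<Longrightarrow> x + y \<in> padic_Ints"
  unfolding padic_Ints_def by (auto simp flip: of_padic_int_add)

lemma padic_Ints_uminus: "x \<in> padic_Ints \<Longrightarrow> - x \<in> padic_Ints"
  unfolding padic_Ints_def by (auto simp flip: of_padic_int_uminus)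

lemma padic_Ints_mult: "x \<in> padic_Ints \<Longrightarrow> y \<in> padic_Ints \<Longrightarrow> x * y \<in> padic_Ints"
  unfolding padic_Ints_def by (auto simp flip: of_padic_int_mult)

lemma padic_Ints_of_nat: "of_nat n \<in> padic_Ints"
  unfolding padic_Ints_def by (metis of_padic_int_of_nat rangeI)

lemma padic_Ints_power: "x \<in> padic_Ints \<Longrightarrow> x ^ n \<in> padic_Ints"
  unfolding padic_Ints_def by (auto simp flip: of_padic_int_power)


section \<open>The p-adic metric\<close>

text \<open>
  The norm of \<open>x\<close> is the infimum of the \<open>p powi (-n)\<close> over all integers \<open>n\<close> with
  \<open>x \<in> p ^ n \<int>\<^sub>p\<close>; so it is \<open>0\<close> for \<open>x = 0\<close>.
\<close>

definition padic_val_ge :: "'p::prime_card padic \<Rightarrow> int \<Rightarrow> bool" where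
  "padic_val_ge x n \<longleftrightarrow> (\<exists>t\<in>padic_Ints. x = of_nat CARD('p) powi n * t)"

definition padic_norm :: "'p::prime_card padic \<Rightarrow> real" where
  "padic_norm x = Inf {real CARD('p) powi (- n) | n. padic_val_ge x n}"

lemma of_nat_CARD_neq_0 [simp]: "(of_nat CARD('p::prime_card) :: 'p padic) \<noteq> 0"
  using CARD_prime_card_gt_1[where 'p = 'p] by (simp del: zero_less_card_finite)

lemma padic_val_ge_mono:
  fixes x :: "'p::prime_card padic"
  assumes "padic_val_ge x n" "m \<le> n"
  shows "padic_val_ge x m"
proof -
  let ?p = "of_nat CARD('p) :: 'p padic"
  obtain t where t: "t \<in> padic_Ints" "x = ?p powi n * t" using assms(1) padic_val_ge_def by blast
  have "?p powi n = ?p powi m * ?p powi (n - m)" by (simp flip: power_int_add)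
  also have "?p powi (n - m) = ?p ^ nat (n - m)" using assms(2) by (simp add: power_int_def)
  finally have "x = ?p powi m * (?p ^ nat (n - m) * t)" using t(2) by (simp add: mult.assoc)
  then show ?thesis unfolding padic_val_ge_def
    using padic_Ints_mult[OF padic_Ints_power[OF padic_Ints_of_nat] t(1)] by blast
qed

lemma padic_val_ge_add: "padic_val_ge x n \<Longrightarrow> padic_val_ge y n \<Longrightarrow> padic_val_ge (x + y) n"
  unfolding padic_val_ge_def by (metis distrib_left padic_Ints_add)

lemma padic_val_ge_uminus: "padic_val_ge x n \<Longrightarrow> padic_val_ge (- x) n"
  unfolding padic_val_ge_def by (metis mult_minus_right padic_Ints_uminus)

lemma padic_val_ge_0 [simp]: "padic_val_ge 0 n"
  unfolding padic_val_ge_def by (rule bexI[of _ 0]) simp_all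

lemma padic_val_ge_exists: "\<exists>n. padic_val_ge (x :: 'p::prime_card padic) n"
proof -
  let ?p = "of_nat CARD('p) :: 'p padic"
  obtain a b where ab: "b \<noteq> 0" "x = of_padic_int a / of_padic_int b" using padic_quotient by blast
  obtain k u where b: "b = of_nat CARD('p) ^ k * u" and u: "Rep_padic_int u 1 \<noteq> 0"
    using padic_int_decompose[OF ab(1)] by blast
  obtain v where v: "u * v = 1" using padic_int_unit[OF u] by blast
  then have uv: "of_padic_int u * of_padic_int v = 1" by (simp flip: of_padic_int_mult)
  then have "of_padic_int u \<noteq> 0" by auto
  then have "x = of_padic_int a * of_padic_int v / ?p ^ k"
    using uv unfolding ab(2) b by (simp add: field_simps)
  then have "x = ?p powi (- int k) * of_padic_int (a * v)"
    by (simp add: power_int_minus field_simps)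
  then show ?thesis unfolding padic_val_ge_def padic_Ints_def by blast
qed

lemma padic_val_ge_all:
  assumes "\<And>n. padic_val_ge (x :: 'p::prime_card padic) n"
  shows "x = 0"
proof -
  obtain a b where ab: "b \<noteq> 0" "x = of_padic_int a / of_padic_int b" using padic_quotient by blast
  have "Rep_padic_int a n = 0" for n
  proof -
    obtain t where "x = of_nat CARD('p) powi (int n) * of_padic_int t"
      using assms[of "int n"] unfolding padic_val_ge_def padic_Ints_def by blast
    then have "of_padic_int a = of_nat CARD('p) ^ n * of_padic_int t * of_padic_int b"
      using ab by (simp add: field_simps flip: of_padic_int_0)
    also have "\<dots> = of_padic_int (of_nat (CARD('p) ^ n) * (t * b))" by (simp add: mult.assoc)
    finally have "a = of_nat (CARD('p) ^ n) * (t * b)" by (simp only: of_padic_int_eq_iff)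
    then show ?thesis
      by (simp only: times_padic_int.rep_eq Rep_padic_int_of_nat) simp
  qed
  then have "a = 0" by (intro padic_int_eqI) (simp add: zero_padic_int.rep_eq)
  then show ?thesis using ab by simp
qed

lemma padic_norm_set:
  fixes x :: "'p::prime_card padic"
  defines "S \<equiv> {real CARD('p) powi (- n) | n. padic_val_ge x n}"
  shows "S \<noteq> {}" "bdd_below S" "s \<in> S \<Longrightarrow> 0 < s"
proof -
  have pos: "0 < s" if "s \<in> S" for s
    using that CARD_prime_card_gt_1[where 'p = 'p] by (auto simp: S_def)
  show "S \<noteq> {}" using padic_val_ge_exists[of x] by (auto simp: S_def)
  show "bdd_below S" by (rule bdd_belowI[of _ 0]) (use pos in force)
  show "s \<in> S \<Longrightarrow> 0 < s" by (rule pos)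
qed

lemma padic_norm_nonneg: "padic_norm x \<ge> 0"
  unfolding padic_norm_def by (rule cInf_greatest[OF padic_norm_set(1)]) (rule less_imp_le[OF padic_norm_set(3)])

lemma padic_norm_le:
  "padic_val_ge (x :: 'p::prime_card padic) n \<Longrightarrow> padic_norm x \<le> real CARD('p) powi (- n)"
  unfolding padic_norm_def by (rule cInf_lower) (auto intro: padic_norm_set(2))

lemma padic_powi_small:
  assumes "e > 0"
  shows "\<exists>n::nat. real CARD('p::prime_card) powi (- int n) < e"
proof -
  have "inverse (real CARD('p)) < 1"
    using CARD_prime_card_gt_1[where 'p = 'p] by (simp add: field_simps)
  then obtain n where "inverse (real CARD('p)) ^ n < e"
    using real_arch_pow_inv[OF assms] by blast
  then show ?thesis by (auto simp: power_int_minus power_inverse)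
qed

lemma padic_norm_eq_0_iff: "padic_norm (x :: 'p::prime_card padic) = 0 \<longleftrightarrow> x = 0"
proof
  assume "x = 0"
  have "padic_norm x \<le> e" if e: "e > 0" for e
  proof -
    obtain n where "real CARD('p) powi (- int n) < e" using padic_powi_small[OF e] by blast
    then show ?thesis using padic_norm_le[of x "int n"] \<open>x = 0\<close> by simp
  qed
  then have "padic_norm x \<le> 0" by (rule dense_ge)
  then show "padic_norm x = 0" using padic_norm_nonneg[of x] by simp
next
  assume 0: "padic_norm x = 0"
  show "x = 0"
  proof (rule padic_val_ge_all)
    fix m :: int
    let ?S = "{real CARD('p) powi (- n) | n. padic_val_ge x n}"
    have pos: "real CARD('p) powi (- m) > 0" by simp
    then have "Inf ?S < real CARD('p) powi (- m)" using 0 unfolding padic_norm_def by simp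
    from cInf_lessD[OF padic_norm_set(1) this]
    obtain s where "s \<in> ?S" "s < real CARD('p) powi (- m)" by blast
    then obtain n where n: "padic_val_ge x n" "real CARD('p) powi (- n) < real CARD('p) powi (- m)"
      by blast
    have "m \<le> n"
    proof (rule ccontr)
      assume "\<not> m \<le> n"
      then have "real CARD('p) powi (- m) \<le> real CARD('p) powi (- n)"
        using CARD_prime_card_gt_1[where 'p = 'p] by (intro power_int_increasing) auto
      with n(2) show False by simp
    qed
    with n(1) show "padic_val_ge x m" by (rule padic_val_ge_mono)
  qed
qed

lemma padic_norm_uminus: "padic_norm (- x) = padic_norm x"
proof -
  have "padic_val_ge (- x) n \<longleftrightarrow> padic_val_ge x n" for n
    using padic_val_ge_uminus[of x n] padic_val_ge_uminus[of "- x" n] by auto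
  then show ?thesis unfolding padic_norm_def by simp
qed

lemma padic_norm_triangle: "padic_norm (x + y) \<le> padic_norm x + padic_norm (y :: 'p::prime_card padic)"
proof -
  let ?q = "\<lambda>n. real CARD('p) powi (- n)"
  have *: "padic_norm (x + y) \<le> ?q m + ?q n" if "padic_val_ge x m" "padic_val_ge y n" for m n
  proof -
    have "padic_val_ge (x + y) (min m n)"
      using that by (intro padic_val_ge_add) (auto intro: padic_val_ge_mono)
    then have "padic_norm (x + y) \<le> ?q (min m n)" by (rule padic_norm_le)
    also have "\<dots> \<le> ?q m + ?q n" by (cases "m \<le> n") (simp_all add: min_def)
    finally show ?thesis .
  qed
  have **: "padic_norm (x + y) - ?q n \<le> padic_norm x" if "padic_val_ge y n" for n
    unfolding padic_norm_def[of x]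
    by (rule cInf_greatest[OF padic_norm_set(1)]) (use *[OF _ that] in fastforce)
  have "padic_norm (x + y) - padic_norm x \<le> padic_norm y"
    unfolding padic_norm_def[of y]
    by (rule cInf_greatest[OF padic_norm_set(1)]) (use ** in fastforce)
  then show ?thesis by simp
qed

instantiation padic :: (prime_card) metric_space
begin

definition dist_padic :: "'a padic \<Rightarrow> 'a padic \<Rightarrow> real" where
  "dist_padic x y = padic_norm (x - y)"

definition uniformity_padic :: "('a padic \<times> 'a padic) filter" where
  "uniformity_padic = (INF e\<in>{0<..}. principal {(x, y). dist x y < e})"

definition open_padic :: "'a padic set \<Rightarrow> bool" where
  "open_padic U \<longleftrightarrow> (\<forall>x\<in>U. eventually (\<lambda>(x', y). x' = x \<longrightarrow> y \<in> U) uniformity)"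

instance
proof
  fix x y z :: "'a padic"
  show "dist x y = 0 \<longleftrightarrow> x = y" by (simp add: dist_padic_def padic_norm_eq_0_iff)
  have "dist x y \<le> padic_norm (x - z) + padic_norm (z - y)"
    using padic_norm_triangle[of "x - z" "z - y"] by (simp add: dist_padic_def)
  also have "padic_norm (z - y) = dist y z"
    using padic_norm_uminus[of "z - y"] by (simp add: dist_padic_def)
  finally show "dist x y \<le> dist x z + dist y z" by (simp add: dist_padic_def)
qed (simp_all add: uniformity_padic_def open_padic_def)

end


section \<open>Residues, powers and truncated hypergeometric sums\<close>

definition padic_residue :: "'p::prime_card padic \<Rightarrow> int" where
  "padic_residue x = (THE r. 0 \<le> r \<and> r < int CARD('p) \<and> padic_cong 1 x (of_int r))"

lemma padic_residue_ex1:
  assumes "(x :: 'p::prime_card padic) \<in> padic_Ints"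
  shows "\<exists>!r. 0 \<le> r \<and> r < int CARD('p) \<and> padic_cong 1 x (of_int r)"
proof -
  let ?p = "int CARD('p)"
  obtain a where x: "x = of_padic_int a" using assms by (auto simp: padic_Ints_def)
  have key: "padic_cong 1 x (of_int r) \<longleftrightarrow> Rep_padic_int a 1 = r"
    if rb: "0 \<le> r" "r < ?p" for r
  proof -
    obtain k where k: "r = int k" using nonneg_int_cases[OF rb(1)] .
    have r: "of_int r = (of_padic_int (of_nat k) :: 'p padic)"
      unfolding k by simp
    have Rr: "Rep_padic_int (of_nat k :: 'p padic_int) 1 = r"
      using rb unfolding k by (simp add: Rep_padic_int_of_nat)
    have Ra: "Rep_padic_int a 1 mod ?p = Rep_padic_int a 1"
      using Rep_padic_int_mod[of 1 1 a] by simp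
    have "padic_cong 1 x (of_int r) \<longleftrightarrow> (\<exists>t. a - of_nat k = of_nat CARD('p) * t)"
      unfolding padic_cong_def padic_Ints_def x r
      by (simp flip: of_padic_int_diff of_padic_int_mult of_padic_int_of_nat)
    also have "\<dots> \<longleftrightarrow> Rep_padic_int (a - of_nat k) 1 = 0"
    proof
      assume "\<exists>t. a - of_nat k = of_nat CARD('p) * t"
      then show "Rep_padic_int (a - of_nat k) 1 = 0"
        by (auto simp: times_padic_int.rep_eq Rep_padic_int_of_nat)
    next
      assume "Rep_padic_int (a - of_nat k) 1 = 0"
      from padic_int_shift[OF this] show "\<exists>t. a - of_nat k = of_nat CARD('p) * t" by auto
    qed
    also have "\<dots> \<longleftrightarrow> Rep_padic_int a 1 mod ?p = r mod ?p"
      unfolding minus_padic_int.rep_eq Rr mod_eq_dvd_iff dvd_eq_mod_eq_0 by simp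
    also have "\<dots> \<longleftrightarrow> Rep_padic_int a 1 = r"
      unfolding Ra mod_pos_pos_trivial[OF rb] ..
    finally show ?thesis .
  qed
  have "Rep_padic_int a 1 mod ?p = Rep_padic_int a 1"
    using Rep_padic_int_mod[of 1 1 a] by simp
  then have "0 \<le> Rep_padic_int a 1" "Rep_padic_int a 1 < ?p"
    using CARD_prime_card_gt_1[where 'p = 'p] by (metis pos_mod_sign pos_mod_bound zero_less_one less_trans)+
  then show ?thesis using key by blast
qed

text \<open>
  An exponent \<open>a + s (p - 1)\<close> is represented by the pair \<open>(a, s)\<close>, with componentwise
  subtraction.  It cannot be replaced by the p-adic number \<open>a + s (p - 1)\<close>: as \<open>p - 1\<close> is a unit
  of \<open>\<int>\<^sub>p\<close>, that number does not determine \<open>a\<close> modulo \<open>p - 1\<close>, hence does not determine the power.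
\<close>

type_synonym 'p padic_exponent = "int \<times> 'p padic"

definition padic_lambda :: "'p::prime_card padic \<Rightarrow> 'p padic_exponent" where
  "padic_lambda \<alpha> =
     (- padic_residue (- \<alpha>), (\<alpha> + of_int (padic_residue (- \<alpha>))) / of_nat CARD('p))"

definition padic_powr :: "'p::prime_card padic \<Rightarrow> 'p padic_exponent \<Rightarrow> 'p padic" where
  "padic_powr w e =
     w powi fst e * (\<Sum>k. (snd e gchoose k) * (w ^ (CARD('p) - 1) - 1) ^ k)"

definition hypergeom_3F2_trunc ::
  "'a::field_char_0 \<Rightarrow> 'a \<Rightarrow> 'a \<Rightarrow> 'a \<Rightarrow> 'a \<Rightarrow> 'a \<Rightarrow> nat \<Rightarrow> 'a" where
  "hypergeom_3F2_trunc a0 a1 a2 b1 b2 z n =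
     (\<Sum>k\<le>n. (pochhammer a0 k * pochhammer a1 k * pochhammer a2 k) /
              (pochhammer b1 k * pochhammer b2 k) * (z ^ k / fact k))"

end

theory Submission
  imports Defs "HOL-Number_Theory.Residues"
begin

text \<open>
  Write \<open>a = \<langle>-\<alpha>\<rangle>\<^sub>p\<close>, \<open>b = \<langle>-\<beta>\<rangle>\<^sub>p\<close> and \<open>\<alpha> = -a + ps\<close>.  Modulo \<open>p\<^sup>2\<close> the sums on the left may be cut
  off at \<open>k \<le> a\<close> and the sum on the right at \<open>2k \<le> a + p\<close>; what remains has denominators prime to
  \<open>p\<close>.  Modulo \<open>p\<^sup>2\<close> both sides are then affine functions of \<open>s\<close>, so it suffices to compare them at
  \<open>s = 0\<close> and \<open>s = -1\<close>, that is at \<open>\<alpha> = -n\<close> with \<open>n = a\<close> and \<open>n = a + p\<close>.  There Whipple's quadratic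
  transformation is an identity of polynomials in \<open>z\<close>.  The symmetry \<open>k \<leftrightarrow> n - k\<close> of its
  left-hand side produces the term with \<open>1/z\<close>, and for \<open>n = a + p\<close> the coefficients with \<open>a < k < p\<close>
  vanish modulo \<open>p\<^sup>2\<close>.
\<close>

section \<open>Whipple's quadratic transformation\<close>

text \<open>The obstacle is the denominator \<open>pochhammer (\<alpha> - \<beta> + 1) k\<close>,
  which acquires a factor p at k = p + a - b. The third hypothesis keeps it from acquiring a second
  one below k = p, and in this range each numerator has a third factor p besides the two that cause
  the cutoff. On the left this is where the second hypothesis enters. The nodes also make the
  exponent 1 - \<lambda> = 1 + a - s (p - 1) a natural number: a + 1 at s = 0, and a + p at s = -1,
  where the first-order approximation of the power is exact. Compared with the degrees n = a and n =
  a + p, the exponent is one too large at the first node only. There both sides are 1 - z times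
  Whipple's identity. At the second node the term with 1/z is the upper part k >= p of the same
  polynomial, and the identity appears as it stands, up to the middle coefficients.\<close>

text \<open>
  The Pfaff--Saalschuetz summation: \<open>pochhammer (\<beta> - k) (M + N)\<close> is
  \<open>(-1)^k * pochhammer (1 - \<beta>) k * pochhammer \<beta> (M + N - k)\<close>.
\<close>

lemma sum_binomial_mult_pochhammer:
  fixes \<beta> :: "'a::field_char_0"
  shows "(\<Sum>k\<le>M. of_nat (M choose k) * of_nat (N choose k) * pochhammer (\<beta> - of_nat k) (M + N))
    = of_nat ((M + N) choose M) * pochhammer \<beta> M * pochhammer \<beta> N"
proof (induction N)
  case 0
  have "(\<Sum>k\<le>M. of_nat (M choose k) * of_nat (0 choose k) * pochhammer (\<beta> - of_nat k) (M + 0))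
    = (\<Sum>k\<le>M. if k = 0 then pochhammer \<beta> M else 0)"
    by (intro sum.cong) (auto simp: binomial_eq_0_iff)
  then show ?case by simp
next
  case (Suc N)
  let ?n = "M + N"
  define f where "f k = pochhammer (\<beta> - of_nat k) (Suc ?n)" for k
  \<comment> \<open>Write t for the \<open>k\<close>-th summand for \<open>N\<close>. Then
    \<open>f k\<close> is t times \<beta> - k + M + N, and \<open>f (Suc k)\<close> is t times
    \<beta> - k - 1. The weights come from (M + N + 1)(\<beta> + N) = (N + k + 1)(\<beta> - k + M +
    N) + (M - k)(\<beta> - k - 1): the two products give \<open>H k\<close> and
    \<open>G (Suc k)\<close>. Shifting the index of \<open>G\<close> back collects the summand for
    \<open>Suc N\<close>.\<close>
  define G where "G k = of_nat (k * (M choose k) * (N choose (k - 1))) * f k" for k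
  define H where "H k = of_nat ((M choose k) * (N choose k) * (N + k + 1)) * f k" for k
  have choose: "(Suc ?n) * (?n choose M) = (Suc N) * (Suc ?n choose M)"
    using Suc_times_binomial[of N ?n] binomial_symmetric[of M ?n] binomial_symmetric[of M "Suc ?n"]
    by (simp del: binomial_Suc_Suc mult_Suc)
  have summand: "of_nat (Suc ?n) * (\<beta> + of_nat N) *
      (of_nat (M choose k) * of_nat (N choose k) * pochhammer (\<beta> - of_nat k) ?n) = H k + G (Suc k)"
    if "k \<le> M" for k
  proof -
    have 1: "f k = pochhammer (\<beta> - of_nat k) ?n * (\<beta> - of_nat k + of_nat ?n)"
      by (simp add: f_def pochhammer_Suc)
    have 2: "f (Suc k) = (\<beta> - of_nat k - 1) * pochhammer (\<beta> - of_nat k) ?n"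
      unfolding f_def pochhammer_rec by (simp add: algebra_simps)
    have "Suc k * (M choose Suc k) = (M - k) * (M choose k)"
      by (simp only: binomial_absorb_comp binomial_absorption)
    then have 3: "G (Suc k) = of_nat ((M - k) * (M choose k) * (N choose k)) * f (Suc k)"
      unfolding G_def by simp
    show ?thesis
      unfolding H_def 3 1 2 using that by (simp add: of_nat_diff algebra_simps)
  qed
  have "(\<Sum>k\<le>M. G (Suc k)) = (\<Sum>k\<le>Suc M. G k)"
    unfolding sum.atMost_Suc_shift by (simp add: G_def)
  also have "\<dots> = (\<Sum>k\<le>M. G k)" by (simp add: G_def)
  finally have shift: "(\<Sum>k\<le>M. G (Suc k)) = (\<Sum>k\<le>M. G k)" .
  have coeff: "H k + G k = of_nat (Suc N) *
      (of_nat (M choose k) * of_nat (Suc N choose k) * f k)" for k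
  proof (cases k)
    case 0
    then show ?thesis by (simp add: G_def H_def)
  next
    case (Suc j)
    have *: "Suc j * (N choose Suc j) = (N - j) * (N choose j)"
      by (simp only: binomial_absorb_comp binomial_absorption)
    have "(N choose Suc j) * (N + Suc j + 1) + Suc j * (N choose j) = Suc N * (Suc N choose Suc j)"
    proof (cases "j \<le> N")
      case True
      then obtain i where i: "N = j + i" using le_Suc_ex by blast
      from * have "Suc j * (N choose Suc j) = i * (N choose j)" by (simp add: i)
      then show ?thesis by (simp add: i algebra_simps)
    qed (simp add: binomial_eq_0)
    then have "(M choose Suc j) * ((N choose Suc j) * (N + Suc j + 1) + Suc j * (N choose j))
      = (M choose Suc j) * (Suc N * (Suc N choose Suc j))" by simp
    then have "of_nat ((M choose Suc j) * (N choose Suc j) * (N + Suc j + 1)) * f (Suc j)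
        + of_nat (Suc j * (M choose Suc j) * (N choose j)) * f (Suc j)
      = of_nat (Suc N * (M choose Suc j) * (Suc N choose Suc j)) * f (Suc j)"
      unfolding distrib_right[symmetric] of_nat_add[symmetric]
      by (intro arg_cong[where f = "\<lambda>x. of_nat x * f (Suc j)"]) (simp add: algebra_simps)
    then show ?thesis unfolding Suc G_def H_def by (simp only: diff_Suc_1 of_nat_mult mult_ac)
  qed
  have "of_nat (Suc N) * (of_nat ((M + Suc N) choose M) * pochhammer \<beta> M * pochhammer \<beta> (Suc N))
    = of_nat (Suc N * (Suc ?n choose M)) * pochhammer \<beta> M * pochhammer \<beta> N * (\<beta> + of_nat N)"
    by (simp only: pochhammer_Suc of_nat_mult add_Suc_right mult_ac)
  also have "\<dots> = of_nat (Suc ?n) * (\<beta> + of_nat N) *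
      (of_nat (?n choose M) * pochhammer \<beta> M * pochhammer \<beta> N)"
    unfolding choose[symmetric] by (simp only: of_nat_mult mult_ac)
  also have "\<dots> = (\<Sum>k\<le>M. H k + G (Suc k))"
    unfolding Suc.IH[symmetric] sum_distrib_left by (intro sum.cong refl summand) simp
  also have "\<dots> = (\<Sum>k\<le>M. H k + G k)" by (simp add: sum.distrib shift)
  also have "\<dots> = of_nat (Suc N) * (\<Sum>k\<le>M. of_nat (M choose k) * of_nat (Suc N choose k) * f k)"
    unfolding coeff by (simp add: sum_distrib_left)
  finally have "(\<Sum>k\<le>M. of_nat (M choose k) * of_nat (Suc N choose k) * f k) =
     of_nat ((M + Suc N) choose M) * pochhammer \<beta> M * pochhammer \<beta> (Suc N)"
    by (simp only: mult_cancel_left of_nat_eq_0_iff) auto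
  then show ?case unfolding f_def by simp
qed

text \<open>Each coefficient on the left is expanded by the preceding summation with
  \<open>M\<close> = m and \<open>N\<close> = n - m. After exchanging the sums, the sum over m for
  fixed k is the binomial expansion of (1 - z)^(n - 2k).\<close>

lemma whipple_polynomial_identity:
  fixes \<beta> z :: "'a::field_char_0"
  shows "(\<Sum>k\<le>n. (-1) ^ k * of_nat (n choose k) ^ 2 * pochhammer \<beta> k * pochhammer \<beta> (n - k) * z ^ k)
    = (\<Sum>k | 2 * k \<le> n. fact n / (fact (n - 2 * k) * fact k ^ 2) * (-1) ^ k
        * pochhammer (\<beta> - of_nat k) n * z ^ k * (1 - z) ^ (n - 2 * k))"
proof -
  define T where "T m k = (-1) ^ m * z ^ m * of_nat (n choose m) *
    (of_nat (m choose k) * of_nat (n - m choose k) * pochhammer (\<beta> - of_nat k) n)" for m k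
  have "(-1) ^ m * of_nat (n choose m) ^ 2 * pochhammer \<beta> m * pochhammer \<beta> (n - m) * z ^ m
    = (\<Sum>k\<le>n. T m k)" if "m \<le> n" for m
  proof -
    have "(\<Sum>k\<le>m. of_nat (m choose k) * of_nat (n - m choose k) * pochhammer (\<beta> - of_nat k) n)
      = of_nat (n choose m) * pochhammer \<beta> m * pochhammer \<beta> (n - m)"
      using sum_binomial_mult_pochhammer[of m "n - m" \<beta>] that by simp
    then have "(-1) ^ m * of_nat (n choose m) ^ 2 * pochhammer \<beta> m * pochhammer \<beta> (n - m) * z ^ m
      = (\<Sum>k\<le>m. T m k)"
      unfolding T_def sum_distrib_left[symmetric] by (simp add: power2_eq_square mult_ac)
    also have "\<dots> = (\<Sum>k\<le>n. T m k)"
      by (rule sum.mono_neutral_left) (use that in \<open>auto simp: T_def binomial_eq_0\<close>)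
    finally show ?thesis .
  qed
  then have "(\<Sum>k\<le>n. (-1) ^ k * of_nat (n choose k) ^ 2 * pochhammer \<beta> k * pochhammer \<beta> (n - k) * z ^ k)
    = (\<Sum>m\<le>n. \<Sum>k\<le>n. T m k)" by (intro sum.cong) auto
  also have "\<dots> = (\<Sum>k\<le>n. \<Sum>m\<le>n. T m k)" by (rule sum.swap)
  also have "\<dots> = (\<Sum>k | 2 * k \<le> n. \<Sum>m\<le>n. T m k)"
    by (rule sum.mono_neutral_right) (auto simp: T_def binomial_eq_0_iff intro!: sum.neutral)
  also have "\<dots> = (\<Sum>k | 2 * k \<le> n. fact n / (fact (n - 2 * k) * fact k ^ 2) * (-1) ^ k
        * pochhammer (\<beta> - of_nat k) n * z ^ k * (1 - z) ^ (n - 2 * k))"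
  proof (intro sum.cong refl)
    fix k assume "k \<in> {k. 2 * k \<le> n}"
    then have k: "2 * k \<le> n" by simp
    define C where "C = fact n / (fact (n - 2 * k) * fact k ^ 2) * (-1) ^ k
        * pochhammer (\<beta> - of_nat k) n * z ^ k"
    have "(\<Sum>m\<le>n. T m k) = (\<Sum>m\<in>{k..n - k}. T m k)"
      by (rule sum.mono_neutral_right) (auto simp: T_def binomial_eq_0_iff)
    also have "\<dots> = (\<Sum>j\<le>n - 2 * k. T (k + j) k)"
      by (rule sum.reindex_bij_witness[of _ "\<lambda>j. k + j" "\<lambda>m. m - k"]) (use k in auto)
    also have "\<dots> = (\<Sum>j\<le>n - 2 * k. C * (of_nat (n - 2 * k choose j) * (- z) ^ j * 1 ^ (n - 2 * k - j)))"
    proof (intro sum.cong refl)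
      fix j assume "j \<in> {..n - 2 * k}"
      then have j: "j \<le> n - 2 * k" by simp
      \<comment> \<open>Both sides equal n! / (k!^2 j! (n - 2k - j)!).\<close>
      have "of_nat (n choose (k + j)) * (of_nat (k + j choose k) * of_nat (n - (k + j) choose k))
         = fact n / (fact (n - 2 * k) * fact k ^ 2) * (of_nat (n - 2 * k choose j) :: 'a)"
      proof -
        have 1: "of_nat (n choose (k + j)) = (fact n / (fact (k + j) * fact (n - (k + j))) :: 'a)"
          using j k by (intro binomial_fact) auto
        have 2: "of_nat (k + j choose k) = (fact (k + j) / (fact k * fact j) :: 'a)"
          using binomial_fact[of k "k + j", where 'a = 'a] by simp
        have 3: "of_nat (n - (k + j) choose k) = (fact (n - (k + j)) / (fact k * fact (n - (k + j) - k)) :: 'a)"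
          using j k by (intro binomial_fact) auto
        have 4: "of_nat (n - 2 * k choose j) = (fact (n - 2 * k) / (fact j * fact (n - 2 * k - j)) :: 'a)"
          using j k by (intro binomial_fact) auto
        have 5: "n - (k + j) - k = n - 2 * k - j" by simp
        show ?thesis unfolding 1 2 3 4 5 by (simp add: field_simps power2_eq_square)
      qed
      then show "T (k + j) k = C * (of_nat (n - 2 * k choose j) * (- z) ^ j * 1 ^ (n - 2 * k - j))"
        unfolding T_def C_def
        by (simp add: power_add power_minus[of z] mult_ac)
    qed
    also have "\<dots> = C * (1 - z) ^ (n - 2 * k)"
      unfolding sum_distrib_left[symmetric] binomial_ring[symmetric] by simp
    finally show "(\<Sum>m\<le>n. T m k) = fact n / (fact (n - 2 * k) * fact k ^ 2) * (-1) ^ k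
        * pochhammer (\<beta> - of_nat k) n * z ^ k * (1 - z) ^ (n - 2 * k)"
      unfolding C_def .
  qed
  finally show ?thesis .
qed

section \<open>The coefficients of both series at \<alpha> = -n\<close>

lemma pochhammer_neg_of_nat:
  fixes n :: nat
  assumes "k \<le> n"
  shows "pochhammer (- of_nat n) k = ((-1) ^ k * (fact n / fact (n - k)) :: 'a::field_char_0)"
proof -
  have "of_nat (n choose k) = ((-1) ^ k * pochhammer (- of_nat n) k / fact k :: 'a)"
    by (simp add: binomial_gbinomial gbinomial_pochhammer)
  moreover have "of_nat (n choose k) = (fact n / (fact k * fact (n - k)) :: 'a)"
    using assms by (rule binomial_fact)
  ultimately have "(-1) ^ k * pochhammer (- of_nat n) k = (fact n / fact (n - k) :: 'a)"
    by (simp add: field_simps)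
  then have "(-1) ^ k * ((-1) ^ k * pochhammer (- of_nat n) k) = ((-1) ^ k * (fact n / fact (n - k)) :: 'a)"
    by simp
  then show ?thesis by (simp flip: power_mult_distrib mult.assoc)
qed

text \<open>The factors of the first symbol are, up to sign, the last \<open>k\<close> factors of
  \<open>pochhammer \<beta> n\<close> in reverse order. At \<alpha> = -n this trades the
  denominators of both series for \<open>pochhammer \<beta> n\<close>, which is independent of
  \<open>k\<close>.\<close>

lemma pochhammer_reflect:
  fixes \<beta> :: "'a::field_char_0"
  assumes "k \<le> n"
  shows "pochhammer (- of_nat n - \<beta> + 1) k * pochhammer \<beta> (n - k) = (-1) ^ k * pochhammer \<beta> n"
proof -
  have *: "\<beta> + of_nat n - 1 - of_nat k + 1 = \<beta> + of_nat (n - k)"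
    using assms by (simp add: of_nat_diff)
  have "pochhammer (- of_nat n - \<beta> + 1) k = (-1) ^ k * pochhammer (\<beta> + of_nat (n - k)) k"
    using pochhammer_minus[of "\<beta> + of_nat n - 1" k] unfolding * by (simp add: algebra_simps)
  moreover have "pochhammer \<beta> n = pochhammer \<beta> (n - k) * pochhammer (\<beta> + of_nat (n - k)) k"
    using pochhammer_product[of "n - k" n \<beta>] assms by simp
  ultimately show ?thesis by simp
qed

lemma pochhammer_shift_down:
  fixes \<beta> :: "'a::field_char_0"
  assumes "k \<le> n"
  shows "pochhammer (\<beta> - of_nat k) n = (-1) ^ k * pochhammer (1 - \<beta>) k * pochhammer \<beta> (n - k)"
proof -
  have "pochhammer (1 - \<beta>) k = (-1) ^ k * pochhammer (\<beta> - of_nat k) k"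
    using pochhammer_minus[of "\<beta> - 1" k] by (simp add: algebra_simps)
  then have "(-1) ^ k * pochhammer (1 - \<beta>) k = pochhammer (\<beta> - of_nat k) k"
    by (simp flip: power_mult_distrib mult.assoc)
  then show ?thesis using pochhammer_product[OF assms, of "\<beta> - of_nat k"] by simp
qed

text \<open>One factorial stems from the lower parameter 1, the other from the 1/k! of the
  series.\<close>

definition well_poised_coeff :: "'a::field_char_0 \<Rightarrow> 'a \<Rightarrow> nat \<Rightarrow> 'a" where
  "well_poised_coeff \<alpha> \<beta> k =
     pochhammer \<alpha> k * pochhammer \<alpha> k * pochhammer \<beta> k / (fact k ^ 2 * pochhammer (\<alpha> - \<beta> + 1) k)"

text \<open>By duplication, \<open>pochhammer \<alpha> (2 * k)\<close> is 4^k times the product of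
  the symbols of \<alpha>/2 and \<alpha>/2 + 1/2. The 4^k is taken from the argument, which becomes
  -z / (1 - z)^2, and divisibility by p can be read off the factors \<alpha> + j.\<close>

definition quadratic_coeff :: "'a::field_char_0 \<Rightarrow> 'a \<Rightarrow> nat \<Rightarrow> 'a" where
  "quadratic_coeff \<alpha> \<beta> k =
     pochhammer (1 - \<beta>) k * pochhammer \<alpha> (2 * k) / (fact k ^ 2 * pochhammer (\<alpha> - \<beta> + 1) k)"

lemma hypergeom_well_poised:
  "hypergeom_3F2_trunc \<alpha> \<alpha> \<beta> 1 (\<alpha> - \<beta> + 1) z n = (\<Sum>k\<le>n. well_poised_coeff \<alpha> \<beta> k * z ^ k)"
  unfolding hypergeom_3F2_trunc_def well_poised_coeff_def
  by (simp add: power2_eq_square mult_ac flip: pochhammer_fact)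

lemma hypergeom_quadratic:
  "hypergeom_3F2_trunc (1 - \<beta>) (1/2 * \<alpha>) (1/2 * \<alpha> + 1/2) 1 (\<alpha> - \<beta> + 1) (- (4 * z / (1 - z) ^ 2)) n
    = (\<Sum>k\<le>n. quadratic_coeff \<alpha> \<beta> k * (- z / (1 - z) ^ 2) ^ k)"
proof -
  have double: "pochhammer \<alpha> (2 * k) = 4 ^ k * (pochhammer (1/2 * \<alpha>) k * pochhammer (1/2 * \<alpha> + 1/2) k)" for k
    using pochhammer_double[of "1/2 * \<alpha>" k] by (simp add: power_mult mult.assoc)
  have power: "(- (4 * z / (1 - z) ^ 2)) ^ k = 4 ^ k * (- z / (1 - z) ^ 2) ^ k" for k
    by (simp flip: power_mult_distrib)
  show ?thesis
    unfolding hypergeom_3F2_trunc_def quadratic_coeff_def double power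
    by (simp add: power2_eq_square mult_ac flip: pochhammer_fact)
qed

lemma well_poised_coeff_neg:
  fixes \<beta> :: "'a::field_char_0"
  assumes "pochhammer \<beta> n \<noteq> 0" and "k \<le> n"
  shows "well_poised_coeff (- of_nat n) \<beta> k =
    (-1) ^ k * of_nat (n choose k) ^ 2 * (pochhammer \<beta> k * pochhammer \<beta> (n - k) / pochhammer \<beta> n)"
proof -
  let ?D = "pochhammer (- of_nat n - \<beta> + 1) k"
  have D: "?D * pochhammer \<beta> (n - k) = (-1) ^ k * pochhammer \<beta> n"
    by (rule pochhammer_reflect) fact
  then have "?D \<noteq> 0" using assms(1) by auto
  have "(-1) ^ k * (?D * pochhammer \<beta> (n - k)) = pochhammer \<beta> n"
    unfolding D by (simp flip: power_mult_distrib mult.assoc)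
  then have inv: "1 / ?D = (-1) ^ k * pochhammer \<beta> (n - k) / pochhammer \<beta> n"
    using \<open>?D \<noteq> 0\<close> assms(1) by (simp add: field_simps)
  have neg: "pochhammer (- of_nat n) k = ((-1) ^ k * (of_nat (n choose k) * fact k) :: 'a)"
    using assms(2) by (simp add: pochhammer_neg_of_nat binomial_fact[where 'a = 'a])
  have "well_poised_coeff (- of_nat n) \<beta> k =
    ((-1) ^ k * (of_nat (n choose k) * fact k)) ^ 2 * pochhammer \<beta> k / fact k ^ 2 * (1 / ?D)"
    unfolding well_poised_coeff_def neg by (simp add: power2_eq_square)
  also have "\<dots> = (-1) ^ k * of_nat (n choose k) ^ 2 *
      (pochhammer \<beta> k * pochhammer \<beta> (n - k) / pochhammer \<beta> n)"
    unfolding inv by (simp add: power_mult_distrib flip: power_mult)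
  finally show ?thesis .
qed

text \<open>In the closed form everything but the sign is invariant under k -> n - k.\<close>

lemma well_poised_coeff_neg_symmetric:
  fixes \<beta> :: "'a::field_char_0"
  assumes "pochhammer \<beta> n \<noteq> 0" and "k \<le> n"
  shows "well_poised_coeff (- of_nat n) \<beta> (n - k) = (-1) ^ n * well_poised_coeff (- of_nat n) \<beta> k"
proof -
  have "(-1) ^ n * (-1) ^ k = ((-1) ^ (n - k) :: 'a)"
    using neg_one_power_add_eq_neg_one_power_diff[OF assms(2), where 'a = 'a] by (simp add: power_add)
  moreover have "n choose (n - k) = n choose k" using assms(2) by (rule binomial_symmetric[symmetric])
  ultimately show ?thesis
    using assms by (simp add: well_poised_coeff_neg mult.assoc mult.left_commute mult.commute)
qed

lemma quadratic_coeff_neg: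
  fixes \<beta> :: "'a::field_char_0"
  assumes "pochhammer \<beta> n \<noteq> 0" and "2 * k \<le> n"
  shows "quadratic_coeff (- of_nat n) \<beta> k =
    fact n / (fact (n - 2 * k) * fact k ^ 2) * pochhammer (\<beta> - of_nat k) n / pochhammer \<beta> n"
proof -
  let ?D = "pochhammer (- of_nat n - \<beta> + 1) k"
  have "k \<le> n" using assms(2) by simp
  have D: "?D * pochhammer \<beta> (n - k) = (-1) ^ k * pochhammer \<beta> n"
    by (rule pochhammer_reflect) fact
  then have "?D \<noteq> 0" using assms(1) by auto
  have "(-1) ^ k * (?D * pochhammer \<beta> (n - k)) = pochhammer \<beta> n"
    unfolding D by (simp flip: power_mult_distrib mult.assoc)
  then have inv: "1 / ?D = (-1) ^ k * pochhammer \<beta> (n - k) / pochhammer \<beta> n"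
    using \<open>?D \<noteq> 0\<close> assms(1) by (simp add: field_simps)
  have "quadratic_coeff (- of_nat n) \<beta> k =
    pochhammer (1 - \<beta>) k * pochhammer (- of_nat n) (2 * k) / fact k ^ 2 * (1 / ?D)"
    unfolding quadratic_coeff_def by simp
  also have "\<dots> = fact n / (fact (n - 2 * k) * fact k ^ 2) *
      pochhammer (\<beta> - of_nat k) n / pochhammer \<beta> n"
    unfolding inv pochhammer_shift_down[OF \<open>k \<le> n\<close>] pochhammer_neg_of_nat[OF assms(2)]
    by (simp add: power_mult)
  finally show ?thesis .
qed

text \<open>This is the polynomial identity divided by \<open>pochhammer \<beta> n\<close>. Taking
  out (1 - z)^n turns z^k (1 - z)^(n - 2k) into a power of z / (1 - z)^2.\<close>

lemma whipple_terminating: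
  fixes \<beta> z :: "'a::field_char_0"
  assumes \<beta>: "pochhammer \<beta> n \<noteq> 0" and z: "z \<noteq> 1"
  shows "(\<Sum>k\<le>n. well_poised_coeff (- of_nat n) \<beta> k * z ^ k)
    = (1 - z) ^ n * (\<Sum>k | 2 * k \<le> n. quadratic_coeff (- of_nat n) \<beta> k * (- z / (1 - z) ^ 2) ^ k)"
proof -
  have "(\<Sum>k\<le>n. well_poised_coeff (- of_nat n) \<beta> k * z ^ k) = (\<Sum>k\<le>n. (-1) ^ k * of_nat (n choose k) ^ 2
      * pochhammer \<beta> k * pochhammer \<beta> (n - k) * z ^ k) / pochhammer \<beta> n"
    unfolding sum_divide_distrib using \<beta> by (intro sum.cong) (simp_all add: well_poised_coeff_neg)
  also have "\<dots> = (1 - z) ^ n * (\<Sum>k | 2 * k \<le> n. quadratic_coeff (- of_nat n) \<beta> k * (- z / (1 - z) ^ 2) ^ k)"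
    unfolding whipple_polynomial_identity sum_divide_distrib sum_distrib_left
  proof (intro sum.cong refl)
    fix k assume "k \<in> {k. 2 * k \<le> n}"
    then have k: "2 * k \<le> n" by simp
    then have "(1 - z) ^ n = (1 - z) ^ (n - 2 * k) * ((1 - z) ^ 2) ^ k"
      by (simp flip: power_mult power_add)
    moreover have "(- z / (1 - z) ^ 2) ^ k = (-1) ^ k * z ^ k / ((1 - z) ^ 2) ^ k"
      by (simp only: power_divide power_minus[of z])
    ultimately have "(1 - z) ^ n * (- z / (1 - z) ^ 2) ^ k = (-1) ^ k * z ^ k * (1 - z) ^ (n - 2 * k)"
      using z by simp
    then show "fact n / (fact (n - 2 * k) * fact k ^ 2) * (-1) ^ k * pochhammer (\<beta> - of_nat k) n
        * z ^ k * (1 - z) ^ (n - 2 * k) / pochhammer \<beta> n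
      = (1 - z) ^ n * (quadratic_coeff (- of_nat n) \<beta> k * (- z / (1 - z) ^ 2) ^ k)"
      unfolding quadratic_coeff_neg[OF \<beta> k] mult.left_commute[of "(1 - z) ^ n"] by simp
  qed
  finally show ?thesis .
qed

section \<open>Congruences of p-adic numbers\<close>

lemma padic_Ints_1 [simp]: "1 \<in> padic_Ints"
  using padic_Ints_of_nat[of 1] by simp

lemma padic_Ints_diff: "x \<in> padic_Ints \<Longrightarrow> y \<in> padic_Ints \<Longrightarrow> x - y \<in> padic_Ints"
  unfolding padic_Ints_def by (auto simp flip: of_padic_int_diff)

lemma padic_Ints_of_int: "of_int n \<in> padic_Ints"
  by (cases n rule: int_diff_cases) (simp add: padic_Ints_diff padic_Ints_of_nat)

lemma padic_Ints_numeral: "numeral n \<in> padic_Ints"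
  using padic_Ints_of_nat[of "numeral n"] by simp

lemma padic_Ints_fact: "fact n \<in> padic_Ints"
  using padic_Ints_of_nat[of "fact n"] by simp

lemma padic_Ints_sum: "(\<And>i. i \<in> A \<Longrightarrow> f i \<in> padic_Ints) \<Longrightarrow> sum f A \<in> padic_Ints"
  by (induction A rule: infinite_finite_induct) (auto intro: padic_Ints_add)

lemma padic_Ints_pochhammer: "x \<in> padic_Ints \<Longrightarrow> pochhammer x n \<in> padic_Ints"
  by (induction n) (auto simp: pochhammer_Suc intro: padic_Ints_add padic_Ints_mult padic_Ints_of_nat)

lemmas padic_Ints_intros =
  padic_Ints_0 padic_Ints_1 padic_Ints_add padic_Ints_diff padic_Ints_uminus padic_Ints_mult
  padic_Ints_power padic_Ints_of_nat padic_Ints_of_int padic_Ints_numeral padic_Ints_fact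
  padic_Ints_sum padic_Ints_pochhammer

lemma padic_cong_0_iff:
  "padic_cong m (x :: 'p::prime_card padic) 0 \<longleftrightarrow> (\<exists>t\<in>padic_Ints. x = of_nat CARD('p) ^ m * t)"
  by (simp add: padic_cong_def)

lemma padic_cong_iff_diff: "padic_cong m x y \<longleftrightarrow> padic_cong m (x - y) 0"
  by (simp add: padic_cong_def)

lemma padic_cong_refl [simp]: "padic_cong m x x"
  unfolding padic_cong_def by (rule bexI[of _ 0]) auto

lemma padic_cong_0_uminus: "padic_cong m x 0 \<Longrightarrow> padic_cong m (- x) 0"
  unfolding padic_cong_0_iff by (metis mult_minus_right padic_Ints_uminus)

lemma padic_cong_0_add: "padic_cong m x 0 \<Longrightarrow> padic_cong m y 0 \<Longrightarrow> padic_cong m (x + y) 0"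
  unfolding padic_cong_0_iff by (metis distrib_left padic_Ints_add)

lemma padic_cong_sym: "padic_cong m x y \<Longrightarrow> padic_cong m y x"
  using padic_cong_0_uminus[of m "x - y"] by (simp add: padic_cong_iff_diff[of _ x] padic_cong_iff_diff[of _ y])

lemma padic_cong_trans [trans]: "padic_cong m x y \<Longrightarrow> padic_cong m y z \<Longrightarrow> padic_cong m x z"
  using padic_cong_0_add[of m "x - y" "y - z"]
  by (simp add: padic_cong_iff_diff[of _ x] padic_cong_iff_diff[of _ y])

lemma padic_cong_add:
  "padic_cong m x x' \<Longrightarrow> padic_cong m y y' \<Longrightarrow> padic_cong m (x + y) (x' + y')"
  using padic_cong_0_add[of m "x - x'" "y - y'"]
  by (simp add: padic_cong_iff_diff[of _ x] padic_cong_iff_diff[of _ y] padic_cong_iff_diff[of _ "x + y"]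
      algebra_simps)

lemma padic_cong_uminus: "padic_cong m x y \<Longrightarrow> padic_cong m (- x) (- y)"
  using padic_cong_0_uminus[of m "x - y"]
  by (simp add: padic_cong_iff_diff[of _ x] padic_cong_iff_diff[of _ "- x"])

lemma padic_cong_diff:
  "padic_cong m x x' \<Longrightarrow> padic_cong m y y' \<Longrightarrow> padic_cong m (x - y) (x' - y')"
  using padic_cong_add[of m x x' "- y" "- y'"] padic_cong_uminus[of m y y'] by simp

lemma padic_cong_sum:
  "(\<And>i. i \<in> A \<Longrightarrow> padic_cong m (f i) (g i)) \<Longrightarrow> padic_cong m (sum f A) (sum g A)"
  by (induction A rule: infinite_finite_induct) (auto intro: padic_cong_add)

lemma padic_cong_0_mult:
  "padic_cong m x 0 \<Longrightarrow> padic_cong n y 0 \<Longrightarrow> padic_cong (m + n) (x * y) 0"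
proof -
  assume "padic_cong m x 0" "padic_cong n y 0"
  then obtain s t where "s \<in> padic_Ints" "t \<in> padic_Ints"
    "x = of_nat CARD('a) ^ m * s" "y = of_nat CARD('a) ^ n * t" unfolding padic_cong_0_iff by blast
  then show ?thesis unfolding padic_cong_0_iff
    by (intro bexI[of _ "s * t"]) (auto simp: power_add padic_Ints_mult)
qed

lemma padic_cong_zero_modulus: "padic_cong 0 x 0 \<longleftrightarrow> x \<in> padic_Ints"
  by (simp add: padic_cong_0_iff)

lemma padic_cong_0_mult_left: "padic_cong m x 0 \<Longrightarrow> y \<in> padic_Ints \<Longrightarrow> padic_cong m (y * x) 0"
  using padic_cong_0_mult[of 0 y m x] by (simp add: padic_cong_zero_modulus)

lemma padic_cong_0_mult_right: "padic_cong m x 0 \<Longrightarrow> y \<in> padic_Ints \<Longrightarrow> padic_cong m (x * y) 0"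
  using padic_cong_0_mult_left[of m x y] by (simp add: mult.commute)

lemma padic_cong_mult:
  assumes "padic_cong m x x'" "padic_cong m y y'" "x' \<in> padic_Ints" "y \<in> padic_Ints"
  shows "padic_cong m (x * y) (x' * y')"
proof -
  have "x * y - x' * y' = (x - x') * y + x' * (y - y')" by (simp add: algebra_simps)
  then show ?thesis
    using assms padic_cong_0_add padic_cong_0_mult_left padic_cong_0_mult_right
    unfolding padic_cong_iff_diff[of m x] padic_cong_iff_diff[of m y] padic_cong_iff_diff[of m "x * y"]
    by metis
qed

lemma padic_cong_power:
  assumes "padic_cong m x y" "x \<in> padic_Ints" "y \<in> padic_Ints"
  shows "padic_cong m (x ^ n) (y ^ n)"
  by (induction n) (use assms in \<open>auto intro: padic_cong_mult padic_Ints_power\<close>)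

lemma padic_cong_pochhammer:
  assumes "padic_cong m x y" "x \<in> padic_Ints" "y \<in> padic_Ints"
  shows "padic_cong m (pochhammer x n) (pochhammer y n)"
  by (induction n)
     (use assms in \<open>auto simp: pochhammer_Suc intro!: padic_cong_mult padic_cong_add padic_Ints_intros\<close>)

lemma padic_cong_mono: "padic_cong m x y \<Longrightarrow> n \<le> m \<Longrightarrow> padic_cong n x y"
proof -
  assume *: "padic_cong m x y" "n \<le> m"
  then obtain t where "t \<in> padic_Ints" "x - y = of_nat CARD('a) ^ m * t"
    unfolding padic_cong_def by blast
  then show ?thesis unfolding padic_cong_def using \<open>n \<le> m\<close>
    by (intro bexI[of _ "of_nat CARD('a) ^ (m - n) * t"])
       (auto simp flip: power_add mult.assoc intro!: padic_Ints_intros)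
qed

lemma padic_Ints_cong: "padic_cong m x y \<Longrightarrow> y \<in> padic_Ints \<Longrightarrow> x \<in> padic_Ints"
  using padic_cong_mono[of m x y 0] padic_Ints_add[of "x - y" y]
  by (auto simp: padic_cong_iff_diff[of 0 x] padic_cong_zero_modulus)

section \<open>Divisibility by p, quotients and units\<close>

lemma padic_cong_of_nat_CARD: "padic_cong 1 (of_nat CARD('p)) (0 :: 'p::prime_card padic)"
  unfolding padic_cong_0_iff by (rule bexI[of _ 1]) auto

lemma padic_cong_of_int_1_iff:
  "padic_cong 1 (of_int r :: 'p::prime_card padic) 0 \<longleftrightarrow> int CARD('p) dvd r"
proof -
  let ?p = "int CARD('p)"
  have pos: "?p > 0" using CARD_prime_card_gt_1[where 'p = 'p] by simp
  have mod_cong: "padic_cong 1 (of_int r :: 'p padic) (of_int (r mod ?p))"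
    unfolding padic_cong_def
  proof (rule bexI)
    have "r = ?p * (r div ?p) + r mod ?p" by simp
    then have "(of_int r :: 'p padic) = of_int (?p * (r div ?p) + r mod ?p)" by (rule arg_cong)
    then show "of_int r - of_int (r mod ?p) = of_nat CARD('p) ^ 1 * (of_int (r div ?p) :: 'p padic)"
      by (simp only: of_int_add of_int_mult of_int_of_nat_eq) simp
  qed (rule padic_Ints_of_int)
  show ?thesis
  proof
    assume "padic_cong 1 (of_int r :: 'p padic) 0"
    then have "padic_cong 1 (0 :: 'p padic) (of_int (r mod ?p))"
      using mod_cong padic_cong_sym padic_cong_trans by blast
    moreover have "padic_cong 1 (0 :: 'p padic) (of_int 0)" by simp
    \<comment> \<open>Uniqueness of the residue of 0 identifies \<open>r mod ?p\<close> with
      0.\<close>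
    moreover have "\<exists>!s. 0 \<le> s \<and> s < ?p \<and> padic_cong 1 (0 :: 'p padic) (of_int s)"
      by (rule padic_residue_ex1) simp
    ultimately have "r mod ?p = 0"
      using pos pos_mod_bound[OF pos, of r] pos_mod_sign[OF pos, of r] by blast
    then show "?p dvd r" by (simp add: dvd_eq_mod_eq_0)
  qed (use mod_cong in \<open>simp add: dvd_eq_mod_eq_0\<close>)
qed

lemma padic_cong_of_nat_1_iff:
  "padic_cong 1 (of_nat r :: 'p::prime_card padic) 0 \<longleftrightarrow> CARD('p) dvd r"
  using padic_cong_of_int_1_iff[of "int r", where 'p = 'p] by (simp add: int_dvd_int_iff)

text \<open>The last assumption bounds the valuation of \<open>y\<close> by \<open>j\<close>, so the
  quotient loses at most \<open>j\<close> of the \<open>m + j\<close> factors p. The case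
  \<open>j\<close> = 1 serves the denominators that may contain a single p.\<close>

lemma padic_cong_0_divide:
  fixes x y :: "'p::prime_card padic"
  assumes x: "padic_cong (m + j) x 0" and y: "y \<in> padic_Ints" "\<not> padic_cong (Suc j) y 0"
  shows "padic_cong m (x / y) 0"
proof -
  let ?P = "of_nat CARD('p) :: 'p padic"
  obtain y' where y': "y = of_padic_int y'" using y(1) by (auto simp: padic_Ints_def)
  have "y' \<noteq> 0" using y(2) unfolding y' by auto
  then obtain k u where k: "y' = of_nat CARD('p) ^ k * u" and u: "Rep_padic_int u 1 \<noteq> 0"
    using padic_int_decompose by blast
  obtain v where v: "u * v = 1" using padic_int_unit[OF u] by blast
  then have uv: "of_padic_int u * of_padic_int v = 1" by (simp flip: of_padic_int_mult)
  have yk: "y = ?P ^ k * of_padic_int u" unfolding y' k by simp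
  then have "padic_cong k y 0" unfolding padic_cong_0_iff by (auto simp: padic_Ints_def)
  then have "k \<le> j" using y(2) padic_cong_mono not_less_eq_eq by blast
  obtain t where t: "t \<in> padic_Ints" "x = ?P ^ (m + j) * t" using x unfolding padic_cong_0_iff by blast
  have "?P ^ (m + j) = ?P ^ m * ?P ^ (j - k) * ?P ^ k"
    using \<open>k \<le> j\<close> by (simp flip: power_add)
  moreover have "of_padic_int u \<noteq> 0" using uv by auto
  ultimately have "x / y = ?P ^ m * (?P ^ (j - k) * t * of_padic_int v)"
    using uv unfolding yk t(2) by (simp add: field_simps)
  then show ?thesis unfolding padic_cong_0_iff using t(1)
    by (intro bexI[of _ "?P ^ (j - k) * t * of_padic_int v"])
       (auto simp: padic_Ints_def[THEN equalityD2, THEN subsetD] intro!: padic_Ints_intros)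
qed

lemma padic_cong_0_divide_unit:
  "padic_cong m x 0 \<Longrightarrow> y \<in> padic_Ints \<Longrightarrow> \<not> padic_cong 1 y 0 \<Longrightarrow> padic_cong m (x / y) 0"
  using padic_cong_0_divide[of m 0 x y] by simp

lemma padic_Ints_divide: "x \<in> padic_Ints \<Longrightarrow> y \<in> padic_Ints \<Longrightarrow> \<not> padic_cong 1 y 0 \<Longrightarrow> x / y \<in> padic_Ints"
  using padic_cong_0_divide_unit[of 0 x y] by (simp add: padic_cong_zero_modulus)

lemma padic_nonunit_mult:
  assumes "x \<in> padic_Ints" "y \<in> padic_Ints" "padic_cong 1 (x * y) 0" "\<not> padic_cong 1 x 0"
  shows "padic_cong 1 y 0"
proof -
  have "x \<noteq> 0" using assms(4) by auto
  then show ?thesis using padic_cong_0_divide_unit[OF assms(3,1,4)] by simp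
qed

lemma padic_unit_power: "x \<in> padic_Ints \<Longrightarrow> \<not> padic_cong 1 x 0 \<Longrightarrow> \<not> padic_cong 1 (x ^ n) 0"
proof (induction n)
  case 0
  then show ?case using padic_cong_of_nat_1_iff[of 1, where 'p = 'a] CARD_prime_card_gt_1[where 'p = 'a]
    by auto
next
  case (Suc n)
  then show ?case using padic_nonunit_mult[of x "x ^ n"] padic_Ints_power by auto
qed

lemma padic_units_iff: "x \<in> padic_units \<longleftrightarrow> x \<in> padic_Ints \<and> \<not> padic_cong 1 x 0"
proof (intro iffI conjI)
  assume "x \<in> padic_units"
  then obtain y where *: "x \<in> padic_Ints" "y \<in> padic_Ints" "x * y = 1" unfolding padic_units_def by blast
  show "x \<in> padic_Ints" by fact
  show "\<not> padic_cong 1 x 0"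
    using padic_cong_0_mult_right[OF _ *(2), of 1 x] *(3) padic_unit_power[of x 0]
      padic_cong_of_nat_1_iff[of 1, where 'p = 'a] CARD_prime_card_gt_1[where 'p = 'a] by auto
next
  assume *: "x \<in> padic_Ints \<and> \<not> padic_cong 1 x 0"
  then have "x \<noteq> 0" by auto
  with * show "x \<in> padic_units" unfolding padic_units_def
    using padic_Ints_divide[of 1 x] by (auto intro!: bexI[of _ "1 / x"])
qed

lemma padic_unit_cong: "padic_cong 1 x y \<Longrightarrow> padic_cong 1 x 0 \<longleftrightarrow> padic_cong 1 y 0"
  using padic_cong_sym padic_cong_trans by blast

lemma padic_cong_0_pochhammer:
  assumes "x \<in> padic_Ints" "padic_cong m (x + of_nat j) 0" "j < k"
  shows "padic_cong m (pochhammer x k) 0"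
proof -
  have "pochhammer x k = pochhammer x j * ((x + of_nat j) * pochhammer (x + of_nat (Suc j)) (k - Suc j))"
    using pochhammer_product[of "Suc j" k x] assms(3) by (simp add: pochhammer_Suc mult_ac)
  moreover have "padic_cong m ((x + of_nat j) * pochhammer (x + of_nat (Suc j)) (k - Suc j)) 0"
    using assms by (intro padic_cong_0_mult_right padic_Ints_intros)
  ultimately show ?thesis using assms
    by (auto intro!: padic_cong_0_mult_left padic_Ints_intros)
qed

lemma padic_unit_pochhammer:
  fixes x :: "'p::prime_card padic"
  assumes "x \<in> padic_Ints" "\<And>j. j < k \<Longrightarrow> \<not> padic_cong 1 (x + of_nat j) 0"
  shows "\<not> padic_cong 1 (pochhammer x k) 0"
  using assms(2)
proof (induction k)
  case 0
  then show ?case using padic_unit_power[of "of_nat 1 :: 'p padic" 0] padic_cong_of_nat_1_iff[of 1, where 'p = 'p]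
      CARD_prime_card_gt_1[where 'p = 'p] by auto
next
  case (Suc k)
  then show ?case using padic_nonunit_mult[of "pochhammer x k" "x + of_nat k"] assms(1)
    by (auto simp: pochhammer_Suc intro: padic_Ints_intros)
qed

lemma padic_unit_fact: "k < CARD('p) \<Longrightarrow> \<not> padic_cong 1 (fact k :: 'p::prime_card padic) 0"
  using padic_cong_of_nat_1_iff[of "fact k", where 'p = 'p] prime_dvd_fact_iff[of "CARD('p)" k]
    prime_card[where 'a = 'p] by simp

text \<open>\<open>w\<close> is congruent to a natural number prime to p, to which Fermat's little
  theorem applies.\<close>

lemma padic_fermat:
  fixes w :: "'p::prime_card padic"
  assumes "w \<in> padic_units"
  shows "padic_cong 1 (w ^ (CARD('p) - 1) - 1) 0"
proof -
  have w: "w \<in> padic_Ints" "\<not> padic_cong 1 w 0" using assms by (simp_all add: padic_units_iff)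
  obtain r where r: "0 \<le> r" "padic_cong 1 w (of_int r)" using padic_residue_ex1[OF w(1)] by blast
  then obtain k where k: "padic_cong 1 w (of_nat k)" by (metis nonneg_int_cases of_int_of_nat_eq)
  then have "\<not> CARD('p) dvd k"
    using w(2) padic_unit_cong[OF k] padic_cong_of_nat_1_iff[of k, where 'p = 'p] by simp
  then have "[k ^ (CARD('p) - 1) = 1] (mod CARD('p))"
    using prime_card[where 'a = 'p] by (rule fermat_theorem[rotated])
  then have "int CARD('p) dvd int (k ^ (CARD('p) - 1)) - 1"
    by (simp add: cong_iff_dvd_diff flip: cong_int_iff)
  then have "padic_cong 1 (of_int (int (k ^ (CARD('p) - 1)) - 1) :: 'p padic) 0"
    by (simp only: padic_cong_of_int_1_iff)
  then have "padic_cong 1 (of_nat k ^ (CARD('p) - 1)) (1 :: 'p padic)"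
    by (subst padic_cong_iff_diff) simp
  then have "padic_cong 1 (w ^ (CARD('p) - 1)) 1"
    using padic_cong_power[OF k w(1) padic_Ints_of_nat] padic_cong_trans by blast
  then show ?thesis by (subst (asm) padic_cong_iff_diff)
qed

text \<open>The difference of the fractions is (x y' - x' y) / (y y'). A positive modulus is what
  carries the unit property from \<open>y'\<close> to \<open>y\<close>.\<close>

lemma padic_cong_divide:
  assumes "padic_cong m x x'" "padic_cong m y y'" "m \<noteq> 0"
    and "x' \<in> padic_Ints" "y' \<in> padic_Ints" and unit: "\<not> padic_cong 1 y' 0"
  shows "padic_cong m (x / y) (x' / y')"
proof -
  have y: "y \<in> padic_Ints" using assms(2,5) by (rule padic_Ints_cong)
  have unit_y: "\<not> padic_cong 1 y 0"
    using unit padic_unit_cong[OF padic_cong_mono[OF assms(2), of 1]] \<open>m \<noteq> 0\<close> by simp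
  then have nz: "y \<noteq> 0" "y' \<noteq> 0" using unit by auto
  have "padic_cong m (x * y') (x' * y)"
    using assms y by (intro padic_cong_mult) (auto intro: padic_cong_sym)
  then have "padic_cong m (x * y' - x' * y) 0" by (subst (asm) padic_cong_iff_diff)
  then have "padic_cong m ((x * y' - x' * y) / y / y') 0"
    using assms y unit_y by (intro padic_cong_0_divide_unit)
  also have "(x * y' - x' * y) / y / y' = x / y - x' / y'" using nz by (simp add: field_simps)
  finally show ?thesis by (subst padic_cong_iff_diff)
qed

text \<open>Used to decide by integer arithmetic which factors of a Pochhammer symbol are divisible
  by p.\<close>

lemma padic_cong_0_add_of_nat_iff:
  fixes x :: "'p::prime_card padic"
  assumes "padic_cong 1 x (of_int c)"
  shows "padic_cong 1 (x + of_nat j) 0 \<longleftrightarrow> int CARD('p) dvd c + int j"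
proof -
  have "padic_cong 1 (x + of_nat j) (of_int c + of_nat j)"
    using assms by (intro padic_cong_add) auto
  also have "of_int c + of_nat j = (of_int (c + int j) :: 'p padic)" by simp
  finally show ?thesis using padic_unit_cong padic_cong_of_int_1_iff by blast
qed

section \<open>The binomial series\<close>

lemma padic_cong_0_val_ge: "padic_cong m x 0 \<longleftrightarrow> padic_val_ge x (int m)"
  by (simp add: padic_cong_0_iff padic_val_ge_def)

lemma padic_nonzero_not_cong:
  assumes "x \<noteq> 0"
  shows "\<exists>e. \<not> padic_cong (Suc e) x 0"
proof -
  obtain n where n: "\<not> padic_val_ge x n" using padic_val_ge_all[of x] assms by blast
  have "\<not> padic_cong (Suc (nat n)) x 0"
    unfolding padic_cong_0_val_ge using n padic_val_ge_mono[of x "int (Suc (nat n))" n] by auto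
  then show ?thesis by blast
qed

lemma padic_cong_0_of_padic_int:
  assumes "Rep_padic_int x n = 0"
  shows "padic_cong n (of_padic_int x) 0"
proof -
  obtain u where "x = of_nat CARD('a) ^ n * u" using padic_int_shift[OF assms] by blast
  then show ?thesis unfolding padic_cong_0_iff padic_Ints_def by auto
qed

lemma padic_Ints_approx:
  fixes x :: "'p::prime_card padic"
  assumes "x \<in> padic_Ints"
  shows "\<exists>r::nat. padic_cong n x (of_nat r)"
proof -
  obtain a where a: "x = of_padic_int a" using assms by (auto simp: padic_Ints_def)
  define r where "r = nat (Rep_padic_int a n)"
  have "Rep_padic_int a n mod int CARD('p) ^ n = Rep_padic_int a n" by (simp add: Rep_padic_int_mod)
  moreover have "int CARD('p) ^ n > 0" using CARD_prime_card_gt_1[where 'p = 'p] by simp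
  ultimately have "Rep_padic_int a n \<ge> 0" by (metis pos_mod_sign)
  then have "Rep_padic_int (a - of_nat r) n = 0"
    unfolding minus_padic_int.rep_eq Rep_padic_int_of_nat r_def by (simp add: Rep_padic_int_mod)
  from padic_cong_0_of_padic_int[OF this] show ?thesis
    by (auto simp: a padic_cong_iff_diff[of n "of_padic_int a"])
qed

text \<open>Binomial coefficients of natural numbers are integral, and \<open>x\<close> is close to
  a natural number: if p^(e + 1) does not divide \<open>fact k\<close>, replacing \<open>x\<close>
  by some \<open>r\<close> congruent to it modulo p^e changes the binomial coefficient by an
  integral amount.\<close>

lemma padic_Ints_gbinomial:
  fixes x :: "'p::prime_card padic"
  assumes "x \<in> padic_Ints"
  shows "x gchoose k \<in> padic_Ints"
proof -
  obtain e where e: "\<not> padic_cong (Suc e) (fact k :: 'p padic) 0"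
    using padic_nonzero_not_cong fact_nonzero by blast
  obtain r :: nat where r: "padic_cong e x (of_nat r)" using padic_Ints_approx[OF assms] by blast
  have "padic_cong e (pochhammer (- x) k) (pochhammer (- of_nat r) k)"
    using r assms by (intro padic_cong_pochhammer padic_cong_uminus padic_Ints_intros)
  then have "padic_cong e (pochhammer (- x) k - pochhammer (- of_nat r) k) 0"
    by (subst (asm) padic_cong_iff_diff)
  then have "padic_cong 0 ((pochhammer (- x) k - pochhammer (- of_nat r) k) / fact k) 0"
    using e by (intro padic_cong_0_divide[where j = e] padic_Ints_fact) simp_all
  then have "(-1) ^ k * ((pochhammer (- x) k - pochhammer (- of_nat r) k) / fact k) \<in> padic_Ints"
    unfolding padic_cong_zero_modulus by (intro padic_Ints_intros)
  moreover have "x gchoose k = of_nat (r choose k) +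
      (-1) ^ k * ((pochhammer (- x) k - pochhammer (- of_nat r) k) / fact k)"
    by (simp add: binomial_gbinomial gbinomial_pochhammer diff_divide_distrib algebra_simps)
  ultimately show ?thesis by (auto intro!: padic_Ints_intros)
qed

text \<open>The terms from index \<open>n\<close> on vanish modulo p^n, so the partial sums
  determine a coherent sequence of residues, which is the limit. The congruences are recorded along
  with convergence because the case \<open>n\<close> = 2 is what evaluates powers modulo
  p^2.\<close>

lemma padic_powser_sums:
  fixes r :: "nat \<Rightarrow> 'p::prime_card padic"
  assumes "\<And>k. r k \<in> padic_Ints"
  obtains L where "(\<lambda>k. of_nat CARD('p) ^ k * r k) sums L"
    "\<And>n. padic_cong n L (\<Sum>k<n. of_nat CARD('p) ^ k * r k)"
proof -
  have "\<forall>k. \<exists>x. r k = of_padic_int x" using assms unfolding padic_Ints_def by blast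
  then obtain c where c: "\<And>k. r k = of_padic_int (c k)" by metis
  define S where "S n = (\<Sum>k<n. of_nat (CARD('p) ^ k) * c k)" for n
  define f where "f n = Rep_padic_int (S n) n" for n
  have f: "f \<in> {x. \<forall>n. x (Suc n) mod int CARD('p) ^ n = x n}"
  proof (rule CollectI, rule allI)
    fix n
    have "f (Suc n) mod int CARD('p) ^ n = Rep_padic_int (S (Suc n)) n"
      unfolding f_def by (rule Rep_padic_int_mod) simp
    also have "\<dots> = f n"
      unfolding f_def S_def sum.lessThan_Suc
        plus_padic_int.rep_eq times_padic_int.rep_eq Rep_padic_int_of_nat
      by (simp add: Rep_padic_int_mod)
    finally show "f (Suc n) mod int CARD('p) ^ n = f n" .
  qed
  define L where "L = of_padic_int (Abs_padic_int f :: 'p padic_int)"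
  have S: "of_padic_int (S n) = (\<Sum>k<n. of_nat CARD('p) ^ k * r k)" for n
    by (induction n) (simp_all add: S_def c)
  have cong: "padic_cong n L (\<Sum>k<n. of_nat CARD('p) ^ k * r k)" for n
  proof -
    have "Rep_padic_int (Abs_padic_int f - S n) n = 0"
      unfolding minus_padic_int.rep_eq using f by (simp add: Abs_padic_int_inverse f_def)
    from padic_cong_0_of_padic_int[OF this] show ?thesis
      unfolding L_def S[symmetric] by (subst padic_cong_iff_diff) simp
  qed
  have "(\<lambda>n. \<Sum>k<n. of_nat CARD('p) ^ k * r k) \<longlonglongrightarrow> L"
  proof (rule metric_LIMSEQ_I)
    fix e :: real assume "e > 0"
    then obtain N where N: "real CARD('p) powi (- int N) < e" using padic_powi_small by blast
    have "dist (\<Sum>k<n. of_nat CARD('p) ^ k * r k) L < e" if "n \<ge> N" for n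
    proof -
      have "padic_cong N ((\<Sum>k<n. of_nat CARD('p) ^ k * r k) - L) 0"
        using padic_cong_mono[OF padic_cong_sym[OF cong[of n]] that]
        by (subst (asm) padic_cong_iff_diff)
      then have "padic_norm ((\<Sum>k<n. of_nat CARD('p) ^ k * r k) - L) \<le> real CARD('p) powi (- int N)"
        unfolding padic_cong_0_val_ge by (rule padic_norm_le)
      then show ?thesis using N by (simp add: dist_padic_def)
    qed
    then show "\<exists>N. \<forall>n\<ge>N. dist (\<Sum>k<n. of_nat CARD('p) ^ k * r k) L < e" by blast
  qed
  then have "(\<lambda>k. of_nat CARD('p) ^ k * r k) sums L" by (simp add: sums_def)
  then show ?thesis using cong that by blast
qed

text \<open>By Fermat's theorem \<open>w ^ (CARD('p) - 1) - 1\<close> is divisible by p, so modulo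
  p^2 only the first two terms of the binomial series remain.\<close>

lemma padic_powr_cong:
  fixes w s :: "'p::prime_card padic"
  assumes w: "w \<in> padic_units" and s: "s \<in> padic_Ints"
  shows "padic_cong 2 (padic_powr w (int n, s)) (w ^ n * (1 + s * (w ^ (CARD('p) - 1) - 1)))"
proof -
  obtain t where t: "t \<in> padic_Ints" "w ^ (CARD('p) - 1) - 1 = of_nat CARD('p) * t"
    using padic_fermat[OF w] unfolding padic_cong_0_iff by auto
  have "(s gchoose k) * t ^ k \<in> padic_Ints" for k
    using s t(1) by (intro padic_Ints_mult padic_Ints_gbinomial padic_Ints_power)
  then obtain L where L: "(\<lambda>k. of_nat CARD('p) ^ k * ((s gchoose k) * t ^ k)) sums L"
    "\<And>n. padic_cong n L (\<Sum>k<n. of_nat CARD('p) ^ k * ((s gchoose k) * t ^ k))"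
    by (rule padic_powser_sums[of "\<lambda>k. (s gchoose k) * t ^ k"]) blast
  have powr: "padic_powr w (int n, s) = w ^ n * L"
    unfolding padic_powr_def t(2) sums_unique[OF L(1)] by (simp add: power_mult_distrib mult_ac)
  have cong: "padic_cong 2 L (1 + s * (w ^ (CARD('p) - 1) - 1))"
    using L(2)[of 2] unfolding t(2) by (simp add: numeral_2_eq_2 mult_ac)
  have "w \<in> padic_Ints" using w by (simp add: padic_units_iff)
  moreover from this have "L \<in> padic_Ints"
    using s by (intro padic_Ints_cong[OF cong] padic_Ints_intros)
  ultimately show ?thesis
    unfolding powr using cong by (intro padic_cong_mult padic_cong_refl padic_Ints_intros)
qed

section \<open>Affine functions modulo the square of p\<close>

text \<open>The slope carries the factor p. Hence the quadratic term of a product carries p^2 and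
  disappears, which closes the class under products and under division by units.\<close>

definition padic_affine :: "('p::prime_card padic \<Rightarrow> 'p padic) \<Rightarrow> bool" where
  "padic_affine f \<longleftrightarrow> (\<exists>A\<in>padic_Ints. \<exists>B\<in>padic_Ints. \<forall>s\<in>padic_Ints.
     padic_cong 2 (f s) (A + of_nat CARD('p) * s * B))"

lemma padic_affineI:
  fixes f :: "'p::prime_card padic \<Rightarrow> 'p padic"
  assumes "A \<in> padic_Ints" "B \<in> padic_Ints"
    "\<And>s. s \<in> padic_Ints \<Longrightarrow> padic_cong 2 (f s) (A + of_nat CARD('p) * s * B)"
  shows "padic_affine f"
  using assms unfolding padic_affine_def by blast

lemma padic_affineE:
  fixes f :: "'p::prime_card padic \<Rightarrow> 'p padic"
  assumes "padic_affine f"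
  obtains A B where "A \<in> padic_Ints" "B \<in> padic_Ints"
    "\<And>s. s \<in> padic_Ints \<Longrightarrow> padic_cong 2 (f s) (A + of_nat CARD('p) * s * B)"
  using assms unfolding padic_affine_def by blast

lemma padic_affine_Ints:
  assumes "padic_affine f" "s \<in> padic_Ints"
  shows "f s \<in> padic_Ints"
proof -
  from assms(1) obtain A B where f: "A \<in> padic_Ints" "B \<in> padic_Ints"
    "\<And>s. s \<in> padic_Ints \<Longrightarrow> padic_cong 2 (f s) (A + of_nat CARD('a) * s * B)"
    by (rule padic_affineE) blast
  show ?thesis
    by (rule padic_Ints_cong[OF f(3)[OF assms(2)]]) (intro padic_Ints_intros f assms)
qed

lemma padic_affine_const: "c \<in> padic_Ints \<Longrightarrow> padic_affine (\<lambda>_. c)"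
  by (rule padic_affineI[of c 0]) auto

lemma padic_affine_linear:
  fixes c :: "'p::prime_card padic"
  shows "c \<in> padic_Ints \<Longrightarrow> padic_affine (\<lambda>s. c + of_nat CARD('p) * s)"
  by (rule padic_affineI[of c 1]) auto

lemma padic_affine_add:
  fixes f g :: "'p::prime_card padic \<Rightarrow> 'p padic"
  assumes "padic_affine f" "padic_affine g"
  shows "padic_affine (\<lambda>s. f s + g s)"
proof -
  from assms(1) obtain A B where f: "A \<in> padic_Ints" "B \<in> padic_Ints"
    "\<And>s. s \<in> padic_Ints \<Longrightarrow> padic_cong 2 (f s) (A + of_nat CARD('p) * s * B)"
    by (rule padic_affineE) blast
  from assms(2) obtain C D where g: "C \<in> padic_Ints" "D \<in> padic_Ints"
    "\<And>s. s \<in> padic_Ints \<Longrightarrow> padic_cong 2 (g s) (C + of_nat CARD('p) * s * D)"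
    by (rule padic_affineE) blast
  show ?thesis
  proof (rule padic_affineI[of "A + C" "B + D"])
    fix s :: "'p padic" assume "s \<in> padic_Ints"
    then have "padic_cong 2 (f s + g s)
      ((A + of_nat CARD('p) * s * B) + (C + of_nat CARD('p) * s * D))"
      using f(3) g(3) by (intro padic_cong_add)
    then show "padic_cong 2 (f s + g s) (A + C + of_nat CARD('p) * s * (B + D))"
      by (simp add: algebra_simps)
  qed (use f g in \<open>auto intro: padic_Ints_intros\<close>)
qed

lemma padic_affine_mult:
  fixes f g :: "'p::prime_card padic \<Rightarrow> 'p padic"
  assumes "padic_affine f" "padic_affine g"
  shows "padic_affine (\<lambda>s. f s * g s)"
proof -
  from assms(1) obtain A B where f: "A \<in> padic_Ints" "B \<in> padic_Ints"
    "\<And>s. s \<in> padic_Ints \<Longrightarrow> padic_cong 2 (f s) (A + of_nat CARD('p) * s * B)"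
    by (rule padic_affineE) blast
  from assms(2) obtain C D where g: "C \<in> padic_Ints" "D \<in> padic_Ints"
    "\<And>s. s \<in> padic_Ints \<Longrightarrow> padic_cong 2 (g s) (C + of_nat CARD('p) * s * D)"
    by (rule padic_affineE) blast
  show ?thesis
  proof (rule padic_affineI[of "A * C" "A * D + B * C"])
    fix s :: "'p padic" assume s: "s \<in> padic_Ints"
    let ?P = "of_nat CARD('p) :: 'p padic"
    have "padic_cong 2 (f s * g s) ((A + ?P * s * B) * (C + ?P * s * D))"
      using f g s padic_affine_Ints[OF assms(2)]
      by (intro padic_cong_mult) (auto intro: padic_Ints_intros)
    also have "padic_cong 2 ((A + ?P * s * B) * (C + ?P * s * D)) (A * C + ?P * s * (A * D + B * C))"
      unfolding padic_cong_def using f g s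
      by (intro bexI[of _ "s * s * B * D"]) (auto simp: algebra_simps power2_eq_square intro: padic_Ints_intros)
    finally show "padic_cong 2 (f s * g s) (A * C + ?P * s * (A * D + B * C))" .
  qed (use f g in \<open>auto intro: padic_Ints_intros\<close>)
qed

lemma padic_affine_sum:
  assumes "\<And>i. i \<in> I \<Longrightarrow> padic_affine (f i)"
  shows "padic_affine (\<lambda>s. \<Sum>i\<in>I. f i s)"
  using assms
proof (induction I rule: infinite_finite_induct)
  case (insert i I)
  then have "padic_affine (\<lambda>s. f i s + (\<Sum>i\<in>I. f i s))"
    by (intro padic_affine_add) simp_all
  with insert show ?case by simp
qed (simp_all add: padic_affine_const)

lemma padic_affine_pochhammer:
  assumes "padic_affine f"
  shows "padic_affine (\<lambda>s. pochhammer (f s) n)"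
proof (induction n)
  case (Suc n)
  then show ?case unfolding pochhammer_Suc
    by (intro padic_affine_mult padic_affine_add assms padic_affine_const padic_Ints_of_nat)
qed (simp add: padic_affine_const)

text \<open>A unit value at 0 is enough, because \<open>g s\<close> is congruent to
  \<open>g 0\<close> modulo p.\<close>

lemma padic_affine_divide:
  fixes f g :: "'p::prime_card padic \<Rightarrow> 'p padic"
  assumes f: "padic_affine f" and g: "padic_affine g" and unit: "\<not> padic_cong 1 (g 0) 0"
  shows "padic_affine (\<lambda>s. f s / g s)"
proof -
  let ?P = "of_nat CARD('p) :: 'p padic"
  from g obtain A B where AB: "A \<in> padic_Ints" "B \<in> padic_Ints"
    and g': "\<And>s. s \<in> padic_Ints \<Longrightarrow> padic_cong 2 (g s) (A + ?P * s * B)"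
    by (rule padic_affineE) blast
  have unit_A: "\<not> padic_cong 1 A 0"
    using padic_unit_cong[OF padic_cong_mono[OF g'[of 0], of 1]] unit by simp
  then have "A \<noteq> 0" by auto
  define C where "C = 1 / A"
  have C: "C \<in> padic_Ints" "A * C = 1"
    unfolding C_def using padic_Ints_divide[of 1 A] AB unit_A \<open>A \<noteq> 0\<close> by auto
  \<comment> \<open>The witnesses are the first-order expansion of 1 / (A + p s B), with
    \<open>C\<close> = 1 / A; the error is a multiple of p^2.\<close>
  have "padic_affine (\<lambda>s. 1 / g s)"
  proof (rule padic_affineI[of C "- B * C * C"])
    fix s :: "'p padic" assume s: "s \<in> padic_Ints"
    have "padic_cong 1 (A + ?P * s * B) (A + 0)"
      using padic_cong_of_nat_CARD s AB by (intro padic_cong_add padic_cong_0_mult_right) auto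
    then have "\<not> padic_cong 1 (g s) 0"
      using padic_unit_cong[OF padic_cong_mono[OF g'[OF s], of 1]] unit_A padic_unit_cong by auto
    then have unit_s: "\<not> padic_cong 1 (g s) 0" "g s \<noteq> 0" by auto
    define h where "h = C + ?P * s * (- B * C * C)"
    have h: "h \<in> padic_Ints" unfolding h_def using s AB C by (auto intro!: padic_Ints_intros)
    have "padic_cong 2 (g s * h) ((A + ?P * s * B) * h)"
      using g'[OF s] s AB h by (intro padic_cong_mult) (auto intro!: padic_Ints_intros)
    also have "padic_cong 2 ((A + ?P * s * B) * h) 1"
    proof -
      have "(A + ?P * s * B) * h = A * C + ?P * s * B * C * (1 - A * C) - ?P ^ 2 * (s * s * B * B * C * C)"
        unfolding h_def by (simp add: algebra_simps power2_eq_square)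
      then have "(A + ?P * s * B) * h - 1 = ?P ^ 2 * (- (s * s * B * B * C * C))"
        unfolding C(2) by simp
      then show ?thesis unfolding padic_cong_def
        by (intro bexI[of _ "- (s * s * B * B * C * C)"]) (use s AB C in \<open>auto intro!: padic_Ints_intros\<close>)
    qed
    finally have "padic_cong 2 (1 - g s * h) 0"
      by (subst padic_cong_iff_diff[symmetric]) (rule padic_cong_sym)
    then have "padic_cong 2 ((1 - g s * h) / g s) 0"
      using padic_affine_Ints[OF g s] unit_s by (intro padic_cong_0_divide_unit)
    also have "(1 - g s * h) / g s = 1 / g s - h" using unit_s by (simp add: field_simps)
    finally show "padic_cong 2 (1 / g s) (C + ?P * s * (- B * C * C))"
      unfolding h_def by (subst padic_cong_iff_diff)
  qed (use AB C in \<open>auto intro!: padic_Ints_intros\<close>)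
  from padic_affine_mult[OF f this] show ?thesis by simp
qed

text \<open>Modulo p^2 an affine h satisfies h(s) = h(0) + s (h(0) - h(-1)), so two values determine
  it.\<close>

lemma padic_affine_cong:
  fixes f g :: "'p::prime_card padic \<Rightarrow> 'p padic"
  assumes "padic_affine f" "padic_affine g" and s: "s \<in> padic_Ints"
    and 0: "padic_cong 2 (f 0) (g 0)" and 1: "padic_cong 2 (f (- 1)) (g (- 1))"
  shows "padic_cong 2 (f s) (g s)"
proof -
  have *: "padic_cong 2 (h s) (h 0 + s * (h 0 - h (- 1)))" if "padic_affine h" for h :: "'p padic \<Rightarrow> 'p padic"
  proof -
    let ?P = "of_nat CARD('p) :: 'p padic"
    from that obtain A B where AB: "A \<in> padic_Ints" "B \<in> padic_Ints"
      and h: "\<And>s. s \<in> padic_Ints \<Longrightarrow> padic_cong 2 (h s) (A + ?P * s * B)"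
      by (rule padic_affineE) blast
    have "padic_cong 2 (h s) (A + ?P * s * B)" by (rule h[OF s])
    also have "A + ?P * s * B = (A + ?P * 0 * B) + s * ((A + ?P * 0 * B) - (A + ?P * (- 1) * B))"
      by (simp add: algebra_simps)
    also have "padic_cong 2 \<dots> (h 0 + s * (h 0 - h (- 1)))"
      using s AB padic_affine_Ints[OF that] padic_Ints_uminus[OF padic_Ints_1]
      by (intro padic_cong_add padic_cong_mult padic_cong_diff padic_cong_refl
          padic_cong_sym[OF h] padic_Ints_intros) auto
    finally show ?thesis .
  qed
  have "padic_cong 2 (f s) (f 0 + s * (f 0 - f (- 1)))" by (rule *) fact
  also have "padic_cong 2 \<dots> (g 0 + s * (g 0 - g (- 1)))"
    using 0 1 s padic_affine_Ints[OF assms(1)] padic_Ints_uminus[OF padic_Ints_1]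
    by (intro padic_cong_add padic_cong_mult padic_cong_diff padic_cong_refl padic_Ints_intros) auto
  also have "padic_cong 2 \<dots> (g s)" by (rule padic_cong_sym, rule *) fact
  finally show ?thesis .
qed

lemma padic_affine_power_correction:
  fixes w :: "'p::prime_card padic"
  assumes "w \<in> padic_units"
  shows "padic_affine (\<lambda>s. 1 + - s * (w ^ (CARD('p) - 1) - 1))"
proof -
  obtain t where "t \<in> padic_Ints" "w ^ (CARD('p) - 1) - 1 = of_nat CARD('p) * t"
    using padic_fermat[OF assms] unfolding padic_cong_0_iff by auto
  then show ?thesis
    by (intro padic_affineI[of 1 "- t"] padic_Ints_intros) (simp_all add: mult_ac)
qed

section \<open>The congruence\<close>

text \<open>Collects what depends only on \<beta> and the two residues; \<alpha> varies with s and
  is supplied lemma by lemma. Fixing \<beta> here permits one instance for the given \<beta> and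
  another for a value congruent to it modulo p^2.\<close>

locale whipple_residues =
  fixes a b :: nat and \<beta> :: "'p::prime_card padic"
  assumes \<beta>_Int: "\<beta> \<in> padic_Ints" and \<beta>_cong: "padic_cong 1 \<beta> (of_int (- int b))"
    and a_le_b: "a \<le> b" and b_less: "b < CARD('p)" and two_b_less: "2 * b < CARD('p) + a"
begin

section \<open>Factors p in the denominators and vanishing of the tails\<close>

lemma padic_cong_denominator:
  assumes "padic_cong 1 \<alpha> (of_int (- int a))"
  shows "padic_cong 1 (\<alpha> - \<beta> + 1) (of_int (int b - int a + 1))"
proof -
  have "padic_cong 1 (\<alpha> - \<beta> + 1) (of_int (- int a) - of_int (- int b) + 1)"
    using assms \<beta>_cong by (intro padic_cong_add padic_cong_diff) auto
  then show ?thesis by simp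
qed

text \<open>Modulo p the factors of the symbol are b - a + 1, ..., b - a + k, all strictly between 0
  and p.\<close>

lemma denominator_unit:
  assumes "\<alpha> \<in> padic_Ints" "padic_cong 1 \<alpha> (of_int (- int a))" "k < CARD('p)" "k + b < CARD('p) + a"
  shows "\<not> padic_cong 1 (fact k ^ 2 * pochhammer (\<alpha> - \<beta> + 1) k) 0"
proof -
  have poch: "\<not> padic_cong 1 (pochhammer (\<alpha> - \<beta> + 1) k) 0"
  proof (rule padic_unit_pochhammer)
    fix j assume "j < k"
    then have "0 < int b - int a + 1 + int j" "int b - int a + 1 + int j < int CARD('p)"
      using a_le_b assms(4) by linarith+
    then show "\<not> padic_cong 1 (\<alpha> - \<beta> + 1 + of_nat j) 0"
      unfolding padic_cong_0_add_of_nat_iff[OF padic_cong_denominator[OF assms(2)]]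
      by (rule zdvd_not_zless)
  qed (intro padic_Ints_intros assms \<beta>_Int)
  have fact: "\<not> padic_cong 1 (fact k ^ 2 :: 'p padic) 0"
    using assms(3) by (intro padic_unit_power padic_unit_fact padic_Ints_fact)
  show ?thesis
  proof
    assume *: "padic_cong 1 (fact k ^ 2 * pochhammer (\<alpha> - \<beta> + 1) k) 0"
    have "padic_cong 1 (pochhammer (\<alpha> - \<beta> + 1) k) 0"
      by (rule padic_nonunit_mult[OF _ _ * fact]) (intro padic_Ints_intros assms \<beta>_Int)+
    with poch show False by contradiction
  qed
qed

text \<open>\<open>fact k\<close> is a unit, and the symbol of length \<open>k\<close> divides the
  one of length p - 1; so the denominator contains p at most once.\<close>

lemma denominator_not_cong_2:
  assumes "\<alpha> \<in> padic_Ints" "\<not> padic_cong 2 (pochhammer (\<alpha> - \<beta> + 1) (CARD('p) - 1)) 0" "k < CARD('p)"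
  shows "\<not> padic_cong 2 (fact k ^ 2 * pochhammer (\<alpha> - \<beta> + 1) k) 0"
proof
  assume *: "padic_cong 2 (fact k ^ 2 * pochhammer (\<alpha> - \<beta> + 1) k) 0"
  have unit: "\<not> padic_cong 1 (fact k ^ 2 :: 'p padic) 0"
    using assms(3) by (intro padic_unit_power padic_unit_fact padic_Ints_fact)
  have "padic_cong 2 (fact k ^ 2 * pochhammer (\<alpha> - \<beta> + 1) k / fact k ^ 2) 0"
    by (intro padic_cong_0_divide_unit * unit padic_Ints_intros)
  then have "padic_cong 2 (pochhammer (\<alpha> - \<beta> + 1) k) 0" by simp
  moreover have "pochhammer (\<alpha> - \<beta> + 1) (CARD('p) - 1) = pochhammer (\<alpha> - \<beta> + 1) k *
      pochhammer (\<alpha> - \<beta> + 1 + of_nat k) (CARD('p) - 1 - k)"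
    using assms(3) by (intro pochhammer_product) simp
  ultimately have "padic_cong 2 (pochhammer (\<alpha> - \<beta> + 1) (CARD('p) - 1)) 0"
    using assms(1) \<beta>_Int by (auto intro!: padic_cong_0_mult_right padic_Ints_intros)
  with assms(2) show False by contradiction
qed

text \<open>Both symbols of \<alpha> contain the factor \<alpha> + a, which gives p^2. If the
  denominator contains p, then k >= p + a - b > b by \<open>two_b_less\<close>, and
  \<open>pochhammer \<beta> k\<close> supplies a third p.\<close>

lemma well_poised_coeff_vanish:
  assumes \<alpha>: "\<alpha> \<in> padic_Ints" "padic_cong 1 \<alpha> (of_int (- int a))"
    and iii: "\<not> padic_cong 2 (pochhammer (\<alpha> - \<beta> + 1) (CARD('p) - 1)) 0"
    and k: "a < k" "k < CARD('p)"
  shows "padic_cong 2 (well_poised_coeff \<alpha> \<beta> k) 0"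
proof -
  have "padic_cong 1 (\<alpha> + of_nat a) 0"
    unfolding padic_cong_0_add_of_nat_iff[OF \<alpha>(2)] by simp
  then have "padic_cong 1 (pochhammer \<alpha> k) 0"
    using \<alpha>(1) k(1) by (intro padic_cong_0_pochhammer)
  then have "padic_cong (1 + 1) (pochhammer \<alpha> k * pochhammer \<alpha> k) 0"
    by (intro padic_cong_0_mult)
  then have num: "padic_cong 2 (pochhammer \<alpha> k * pochhammer \<alpha> k) 0"
    by (simp only: one_add_one)
  have den: "fact k ^ 2 * pochhammer (\<alpha> - \<beta> + 1) k \<in> padic_Ints"
    by (intro padic_Ints_intros \<alpha> \<beta>_Int)
  show ?thesis
  proof (cases "k + b < CARD('p) + a")
    case True
    have "padic_cong 2 (pochhammer \<alpha> k * pochhammer \<alpha> k * pochhammer \<beta> k) 0"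
      by (rule padic_cong_0_mult_right[OF num]) (intro padic_Ints_intros \<beta>_Int)
    then show ?thesis unfolding well_poised_coeff_def
      by (rule padic_cong_0_divide_unit[OF _ den denominator_unit[OF \<alpha> k(2) True]])
  next
    case False
    then have "b < k" using two_b_less by linarith
    have "padic_cong 1 (\<beta> + of_nat b) 0"
      unfolding padic_cong_0_add_of_nat_iff[OF \<beta>_cong] by simp
    then have "padic_cong 1 (pochhammer \<beta> k) 0"
      using \<beta>_Int \<open>b < k\<close> by (intro padic_cong_0_pochhammer)
    then have "padic_cong (2 + 1) (pochhammer \<alpha> k * pochhammer \<alpha> k * pochhammer \<beta> k) 0"
      by (intro padic_cong_0_mult num)
    moreover have "\<not> padic_cong (Suc 1) (fact k ^ 2 * pochhammer (\<alpha> - \<beta> + 1) k) 0"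
      using denominator_not_cong_2[OF \<alpha>(1) iii k(2)] by (simp add: numeral_2_eq_2)
    ultimately show ?thesis
      unfolding well_poised_coeff_def by (rule padic_cong_0_divide[OF _ den])
  qed
qed

text \<open>Here p^2 comes from the factors \<alpha> + a and \<alpha> + a + p of
  \<open>pochhammer \<alpha> (2 * k)\<close>. If the denominator contains p, then k >= p + a - b >=
  p - b, and \<open>pochhammer (1 - \<beta>) k\<close> contains the factor of index p - 1 - b, which
  is divisible by p.\<close>

lemma quadratic_coeff_vanish:
  assumes \<alpha>: "\<alpha> \<in> padic_Ints" "padic_cong 1 \<alpha> (of_int (- int a))"
    and iii: "\<not> padic_cong 2 (pochhammer (\<alpha> - \<beta> + 1) (CARD('p) - 1)) 0"
    and k: "a + CARD('p) < 2 * k" "k < CARD('p)"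
  shows "padic_cong 2 (quadratic_coeff \<alpha> \<beta> k) 0"
proof -
  have "padic_cong 1 (pochhammer \<alpha> (Suc a)) 0"
    by (rule padic_cong_0_pochhammer[OF \<alpha>(1), of 1 a])
       (simp_all add: padic_cong_0_add_of_nat_iff[OF \<alpha>(2), unfolded One_nat_def])
  moreover have "padic_cong 1 (pochhammer (\<alpha> + of_nat (Suc a)) (2 * k - Suc a)) 0"
  \<comment> \<open>Counted from \<alpha> + a + 1, the factor \<alpha> + a + p has index p -
    1.\<close>
  proof (rule padic_cong_0_pochhammer[of _ 1 "CARD('p) - 1"])
    have "\<alpha> + of_nat (Suc a) + of_nat (CARD('p) - 1) = \<alpha> + of_nat (a + CARD('p))"
      using b_less by (simp add: of_nat_diff)
    then show "padic_cong 1 (\<alpha> + of_nat (Suc a) + of_nat (CARD('p) - 1)) 0"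
      using padic_cong_0_add_of_nat_iff[OF \<alpha>(2), of "a + CARD('p)"] by simp
    show "CARD('p) - 1 < 2 * k - Suc a" using k b_less by linarith
  qed (intro padic_Ints_intros \<alpha>)
  ultimately have "padic_cong (1 + 1) (pochhammer \<alpha> (Suc a) * pochhammer (\<alpha> + of_nat (Suc a)) (2 * k - Suc a)) 0"
    by (rule padic_cong_0_mult)
  then have num: "padic_cong 2 (pochhammer \<alpha> (2 * k)) 0"
    using pochhammer_product[of "Suc a" "2 * k" \<alpha>] k by (simp add: numeral_2_eq_2)
  have den: "fact k ^ 2 * pochhammer (\<alpha> - \<beta> + 1) k \<in> padic_Ints"
    by (intro padic_Ints_intros \<alpha> \<beta>_Int)
  show ?thesis
  proof (cases "k + b < CARD('p) + a")
    case True
    have "padic_cong 2 (pochhammer (1 - \<beta>) k * pochhammer \<alpha> (2 * k)) 0"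
      by (rule padic_cong_0_mult_left[OF num]) (intro padic_Ints_intros \<beta>_Int)
    then show ?thesis unfolding quadratic_coeff_def
      by (rule padic_cong_0_divide_unit[OF _ den denominator_unit[OF \<alpha> k(2) True]])
  next
    case False
    have "padic_cong 1 (1 - \<beta>) (of_int 1 - of_int (- int b))"
      using \<beta>_cong by (intro padic_cong_diff) auto
    then have \<beta>': "padic_cong 1 (1 - \<beta>) (of_int (1 + int b))" by simp
    have "padic_cong 1 (1 - \<beta> + of_nat (CARD('p) - 1 - b)) 0"
      unfolding padic_cong_0_add_of_nat_iff[OF \<beta>'] using b_less by (simp add: of_nat_diff)
    then have "padic_cong 1 (pochhammer (1 - \<beta>) k) 0"
      by (rule padic_cong_0_pochhammer[rotated])
         (use False a_le_b b_less in \<open>auto intro!: padic_Ints_intros \<beta>_Int\<close>)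
    from padic_cong_0_mult[OF num this]
    have "padic_cong (2 + 1) (pochhammer (1 - \<beta>) k * pochhammer \<alpha> (2 * k)) 0"
      by (simp only: mult.commute)
    moreover have "\<not> padic_cong (Suc 1) (fact k ^ 2 * pochhammer (\<alpha> - \<beta> + 1) k) 0"
      using denominator_not_cong_2[OF \<alpha>(1) iii k(2)] by (simp add: numeral_2_eq_2)
    ultimately show ?thesis
      unfolding quadratic_coeff_def by (rule padic_cong_0_divide[OF _ den])
  qed
qed

section \<open>The coefficients as functions of s and of \<beta>\<close>

lemma parameter_cong:
  assumes "s \<in> padic_Ints"
  shows "padic_cong 1 (- of_nat a + of_nat CARD('p) * s) (of_int (- int a) :: 'p padic)"
proof -
  have "padic_cong 1 (- of_nat a + of_nat CARD('p) * s) (- of_nat a + 0 :: 'p padic)"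
    using assms padic_cong_of_nat_CARD by (intro padic_cong_add padic_cong_0_mult_right) auto
  then show ?thesis by simp
qed

lemma padic_affine_parameter: "padic_affine (\<lambda>s. - of_nat a + of_nat CARD('p) * s :: 'p padic)"
  by (intro padic_affine_linear padic_Ints_intros)

lemma padic_affine_denominator:
  "padic_affine (\<lambda>s. fact k ^ 2 * pochhammer (- of_nat a + of_nat CARD('p) * s - \<beta> + 1) k)"
proof -
  have "padic_affine (\<lambda>s. - of_nat a - \<beta> + 1 + of_nat CARD('p) * s)"
    by (intro padic_affine_linear padic_Ints_intros \<beta>_Int)
  then have "padic_affine (\<lambda>s. fact k ^ 2 * pochhammer (- of_nat a - \<beta> + 1 + of_nat CARD('p) * s) k)"
    by (intro padic_affine_mult padic_affine_pochhammer padic_affine_const padic_Ints_intros)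
  then show ?thesis by (simp add: algebra_simps)
qed

lemma denominator_unit_0:
  assumes "k < CARD('p)" "k + b < CARD('p) + a"
  shows "\<not> padic_cong 1 (fact k ^ 2 * pochhammer (- of_nat a + of_nat CARD('p) * 0 - \<beta> + 1) k) 0"
  using denominator_unit[OF _ parameter_cong[of 0] assms] by (simp add: padic_Ints_intros)

lemma padic_affine_well_poised_coeff:
  assumes "k < CARD('p)" "k + b < CARD('p) + a"
  shows "padic_affine (\<lambda>s. well_poised_coeff (- of_nat a + of_nat CARD('p) * s) \<beta> k)"
  unfolding well_poised_coeff_def
  by (intro padic_affine_divide padic_affine_mult[of "\<lambda>s. _ s * _ s"] padic_affine_mult
      padic_affine_pochhammer padic_affine_parameter padic_affine_const padic_Ints_intros \<beta>_Int
      padic_affine_denominator denominator_unit_0 assms)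

lemma padic_affine_quadratic_coeff:
  assumes "k < CARD('p)" "k + b < CARD('p) + a"
  shows "padic_affine (\<lambda>s. quadratic_coeff (- of_nat a + of_nat CARD('p) * s) \<beta> k)"
  unfolding quadratic_coeff_def
  by (intro padic_affine_divide padic_affine_mult
      padic_affine_pochhammer padic_affine_parameter padic_affine_const padic_Ints_intros \<beta>_Int
      padic_affine_denominator denominator_unit_0 assms)

text \<open>With unit denominators the coefficient depends on \<beta> only modulo p^2, which permits
  moving \<beta> away from -b.\<close>

lemma padic_cong_well_poised_coeff:
  assumes \<alpha>: "\<alpha> \<in> padic_Ints" "padic_cong 1 \<alpha> (of_int (- int a))"
    and \<beta>': "\<beta>' \<in> padic_Ints" "padic_cong 2 \<beta>' \<beta>"
    and k: "k < CARD('p)" "k + b < CARD('p) + a"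
  shows "padic_cong 2 (well_poised_coeff \<alpha> \<beta>' k) (well_poised_coeff \<alpha> \<beta> k)"
  unfolding well_poised_coeff_def
  by (intro padic_cong_divide denominator_unit padic_cong_mult padic_cong_pochhammer padic_cong_add
      padic_cong_diff padic_cong_refl padic_Ints_intros \<alpha> \<beta>' \<beta>_Int k) simp

lemma padic_cong_quadratic_coeff:
  assumes \<alpha>: "\<alpha> \<in> padic_Ints" "padic_cong 1 \<alpha> (of_int (- int a))"
    and \<beta>': "\<beta>' \<in> padic_Ints" "padic_cong 2 \<beta>' \<beta>"
    and k: "k < CARD('p)" "k + b < CARD('p) + a"
  shows "padic_cong 2 (quadratic_coeff \<alpha> \<beta>' k) (quadratic_coeff \<alpha> \<beta> k)"
  unfolding quadratic_coeff_def
  by (intro padic_cong_divide denominator_unit padic_cong_mult padic_cong_pochhammer padic_cong_add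
      padic_cong_diff padic_cong_refl padic_Ints_intros \<alpha> \<beta>' \<beta>_Int k) simp

lemma well_poised_coeff_Ints:
  assumes "\<alpha> \<in> padic_Ints" "padic_cong 1 \<alpha> (of_int (- int a))" "k < CARD('p)" "k + b < CARD('p) + a"
  shows "well_poised_coeff \<alpha> \<beta> k \<in> padic_Ints"
  unfolding well_poised_coeff_def
  by (intro padic_Ints_divide denominator_unit padic_Ints_intros \<beta>_Int assms)

lemma quadratic_coeff_Ints:
  assumes "\<alpha> \<in> padic_Ints" "padic_cong 1 \<alpha> (of_int (- int a))" "k < CARD('p)" "k + b < CARD('p) + a"
  shows "quadratic_coeff \<alpha> \<beta> k \<in> padic_Ints"
  unfolding quadratic_coeff_def
  by (intro padic_Ints_divide denominator_unit padic_Ints_intros \<beta>_Int assms)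

section \<open>Truncation modulo p^2 and comparison at the nodes\<close>

lemma well_poised_sum_truncate:
  assumes "\<alpha> \<in> padic_Ints" "padic_cong 1 \<alpha> (of_int (- int a))"
    and "\<not> padic_cong 2 (pochhammer (\<alpha> - \<beta> + 1) (CARD('p) - 1)) 0" and x: "x \<in> padic_Ints"
  shows "padic_cong 2 (\<Sum>k\<le>CARD('p) - 1. well_poised_coeff \<alpha> \<beta> k * x ^ k)
    (\<Sum>k\<le>a. well_poised_coeff \<alpha> \<beta> k * x ^ k)"
proof -
  have "padic_cong 2 (\<Sum>k\<le>CARD('p) - 1. well_poised_coeff \<alpha> \<beta> k * x ^ k)
    (\<Sum>k\<le>CARD('p) - 1. if k \<le> a then well_poised_coeff \<alpha> \<beta> k * x ^ k else 0)"
  proof (rule padic_cong_sum)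
    fix k assume "k \<in> {..CARD('p) - 1}"
    then have "k < CARD('p)" using b_less by auto
    then show "padic_cong 2 (well_poised_coeff \<alpha> \<beta> k * x ^ k)
        (if k \<le> a then well_poised_coeff \<alpha> \<beta> k * x ^ k else 0)"
      using assms by (auto intro!: padic_cong_0_mult_right well_poised_coeff_vanish padic_Ints_power)
  qed
  also have "\<dots> = (\<Sum>k\<le>a. well_poised_coeff \<alpha> \<beta> k * x ^ k)"
    using a_le_b b_less by (intro sum.mono_neutral_cong_right) auto
  finally show ?thesis .
qed

lemma quadratic_sum_truncate:
  assumes "\<alpha> \<in> padic_Ints" "padic_cong 1 \<alpha> (of_int (- int a))"
    and "\<not> padic_cong 2 (pochhammer (\<alpha> - \<beta> + 1) (CARD('p) - 1)) 0" and x: "x \<in> padic_Ints"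
  shows "padic_cong 2 (\<Sum>k\<le>CARD('p) - 1. quadratic_coeff \<alpha> \<beta> k * x ^ k)
    (\<Sum>k | 2 * k \<le> a + CARD('p). quadratic_coeff \<alpha> \<beta> k * x ^ k)"
proof -
  have "padic_cong 2 (\<Sum>k\<le>CARD('p) - 1. quadratic_coeff \<alpha> \<beta> k * x ^ k)
    (\<Sum>k\<le>CARD('p) - 1. if 2 * k \<le> a + CARD('p) then quadratic_coeff \<alpha> \<beta> k * x ^ k else 0)"
  proof (rule padic_cong_sum)
    fix k assume "k \<in> {..CARD('p) - 1}"
    then have "k < CARD('p)" using b_less by auto
    then show "padic_cong 2 (quadratic_coeff \<alpha> \<beta> k * x ^ k)
        (if 2 * k \<le> a + CARD('p) then quadratic_coeff \<alpha> \<beta> k * x ^ k else 0)"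
      using assms by (auto intro!: padic_cong_0_mult_right quadratic_coeff_vanish padic_Ints_power)
  qed
  also have "\<dots> = (\<Sum>k | 2 * k \<le> a + CARD('p). quadratic_coeff \<alpha> \<beta> k * x ^ k)"
    using a_le_b b_less by (intro sum.mono_neutral_cong_right) auto
  finally show ?thesis .
qed

text \<open>For a < k < p both k and n - k are below p while n = a + p is not, so p divides the
  binomial coefficient and p^2 its square. What needs work is the integrality of the quotient of
  symbols, since \<open>pochhammer \<beta> n\<close> contains a factor divisible by p.\<close>

lemma well_poised_coeff_middle:
  assumes nz: "pochhammer \<beta> (a + CARD('p)) \<noteq> 0" and k: "a < k" "k < CARD('p)"
  shows "padic_cong 2 (well_poised_coeff (- of_nat (a + CARD('p))) \<beta> k) 0"
proof -
  define n where "n = a + CARD('p)"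
  define X where "X k = pochhammer \<beta> k * pochhammer \<beta> (n - k) / pochhammer \<beta> n" for k
  \<comment> \<open>For k > b the symbol \<open>pochhammer \<beta> k\<close> cancels. The remaining
    factors of the denominator are congruent to k - b, ..., a + p - 1 - b, strictly between 0 and
    p.\<close>
  have X: "X k \<in> padic_Ints" if "b < k" "k \<le> n" for k
  proof -
    have split: "pochhammer \<beta> n = pochhammer \<beta> k * pochhammer (\<beta> + of_nat k) (n - k)"
      using that(2) by (rule pochhammer_product)
    then have "pochhammer \<beta> k \<noteq> 0" using nz n_def by auto
    then have "X k = pochhammer \<beta> (n - k) / pochhammer (\<beta> + of_nat k) (n - k)"
      unfolding X_def split by simp
    also have "\<dots> \<in> padic_Ints"
    proof (intro padic_Ints_divide padic_unit_pochhammer padic_Ints_intros \<beta>_Int)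
      fix j assume "j < n - k"
      then have "0 < - int b + int (k + j)" "- int b + int (k + j) < int CARD('p)"
        using that a_le_b unfolding n_def by linarith+
      then have "\<not> padic_cong 1 (\<beta> + of_nat (k + j)) 0"
        unfolding padic_cong_0_add_of_nat_iff[OF \<beta>_cong] by (rule zdvd_not_zless)
      then show "\<not> padic_cong 1 (\<beta> + of_nat k + of_nat j) 0" by (simp add: add.assoc)
    qed
    finally show ?thesis .
  qed
  have X': "X k \<in> padic_Ints"
  proof (cases "b < k")
    case True
    then show ?thesis using X k by (simp add: n_def)
  next
    case False
    \<comment> \<open>Symmetry reduces k <= b to the first case, as n - k >= a + p - b > b.\<close>
    have "X k = X (n - k)" using k unfolding X_def n_def by (simp add: mult.commute)
    then show ?thesis using X[of "n - k"] False two_b_less by (simp add: n_def)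
  qed
  have "CARD('p) dvd n choose k"
  proof -
    have "CARD('p) dvd fact k * fact (n - k) * (n choose k)"
      using k prime_card[where 'a = 'p] by (simp add: binomial_fact_lemma prime_dvd_fact_iff n_def)
    moreover have "\<not> CARD('p) dvd fact k" "\<not> CARD('p) dvd fact (n - k)"
      using k prime_card[where 'a = 'p] by (simp_all add: prime_dvd_fact_iff n_def)
    ultimately show ?thesis using prime_card[where 'a = 'p] by (simp add: prime_dvd_mult_iff)
  qed
  then have "padic_cong 1 (of_nat (n choose k) :: 'p padic) 0"
    by (simp only: padic_cong_of_nat_1_iff)
  then have "padic_cong (1 + 1) (of_nat (n choose k) * of_nat (n choose k) :: 'p padic) 0"
    by (intro padic_cong_0_mult)
  then have "padic_cong 2 ((-1) ^ k * of_nat (n choose k) ^ 2 * X k) 0"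
    using X' by (intro padic_cong_0_mult_right padic_cong_0_mult_left padic_Ints_intros)
      (simp_all only: power2_eq_square one_add_one)
  moreover have "well_poised_coeff (- of_nat n) \<beta> k = (-1) ^ k * of_nat (n choose k) ^ 2 * X k"
    unfolding X_def using nz k by (intro well_poised_coeff_neg) (simp_all add: n_def)
  ultimately show ?thesis by (simp only: n_def)
qed

text \<open>\<open>F\<close> and \<open>G\<close> are the truncated sides as functions of s, with
  the powers replaced by their values modulo p^2. In \<open>F\<close>, (-z)^(1 + a) (1/z)^k is
  written as (-1)^k (-z)^(1 + a - k), so no inverse of z occurs.\<close>

lemma congruence_interpolation_nodes:
  fixes z :: "'p padic"
  assumes z: "z \<in> padic_units" and z1: "z \<noteq> 1" and nz: "\<beta> \<noteq> - of_nat b"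
  defines "F \<equiv> \<lambda>s. \<Sum>k\<le>a. well_poised_coeff (- of_nat a + of_nat CARD('p) * s) \<beta> k *
      (z ^ k + (-1) ^ k * (- z) ^ (1 + a - k) * (1 + - s * ((- z) ^ (CARD('p) - 1) - 1)))"
    and "G \<equiv> \<lambda>s. (1 - z) ^ (1 + a) * (1 + - s * ((1 - z) ^ (CARD('p) - 1) - 1)) *
      (\<Sum>k | 2 * k \<le> a + CARD('p). quadratic_coeff (- of_nat a + of_nat CARD('p) * s) \<beta> k *
        (- z / (1 - z) ^ 2) ^ k)"
  shows "F 0 = G 0" and "padic_cong 2 (F (- 1)) (G (- 1))"
proof -
  \<comment> \<open>A zero means \<beta> = -j with j < a + p and j congruent to b modulo p; as a <=
    b < p, only j = b is possible.\<close>
  have nz_n: "pochhammer \<beta> n \<noteq> 0" if "n \<le> a + CARD('p)" for n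
  proof
    assume "pochhammer \<beta> n = 0"
    then obtain j where j: "j < n" "\<beta> = - of_nat j" by (auto simp: pochhammer_eq_0_iff)
    then have "int CARD('p) dvd - int b + int j"
      using padic_cong_0_add_of_nat_iff[OF \<beta>_cong, of j] by simp
    then have "int CARD('p) dvd int j - int b" by simp
    moreover have "j \<noteq> b" using j nz by auto
    moreover have "int j - int b < int CARD('p)" "int b - int j < int CARD('p)"
      using j that a_le_b b_less by linarith+
    ultimately show False
      using zdvd_not_zless[of "int j - int b" "int CARD('p)"]
        zdvd_not_zless[of "int b - int j" "int CARD('p)"] dvd_diff_commute
      by (metis diff_gt_0_iff_gt linorder_neqE_nat of_nat_less_iff)
  qed
  define P where "P n = (\<Sum>k\<le>n. well_poised_coeff (- of_nat n) \<beta> k * z ^ k)" for n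
  have P: "P n = (1 - z) ^ n * (\<Sum>k | 2 * k \<le> n. quadratic_coeff (- of_nat n) \<beta> k *
      (- z / (1 - z) ^ 2) ^ k)" if "n \<le> a + CARD('p)" for n
    unfolding P_def by (rule whipple_terminating[OF nz_n[OF that] z1])
  have sign: "(-1) ^ k * (- z) ^ (m - k) = (-1) ^ m * z ^ (m - k)" if "k \<le> m" for m k
    using that by (simp add: power_minus[of z "m - k"] flip: mult.assoc power_add)
  \<comment> \<open>At s = 0 the exponent a + 1 exceeds the degree by one: reflection turns the
    second sum into -z times the first, and the resulting 1 - z matches the extra factor in
    \<open>G 0\<close>.\<close>
  have "F 0 = (\<Sum>k\<le>a. well_poised_coeff (- of_nat a) \<beta> k * z ^ k)
      + (\<Sum>k\<le>a. well_poised_coeff (- of_nat a) \<beta> k * ((-1) ^ k * (- z) ^ (1 + a - k)))"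
    unfolding F_def by (simp add: algebra_simps sum.distrib)
  also have "(\<Sum>k\<le>a. well_poised_coeff (- of_nat a) \<beta> k * ((-1) ^ k * (- z) ^ (1 + a - k)))
    = (\<Sum>k\<le>a. - z * (well_poised_coeff (- of_nat a) \<beta> (a - k) * z ^ (a - k)))"
  proof (intro sum.cong refl)
    fix k assume "k \<in> {..a}"
    then have k: "k \<le> a" by simp
    have "(-1) ^ k * (- z) ^ (1 + a - k) = - z * ((-1) ^ k * (- z) ^ (a - k))"
      using k by (simp add: Suc_diff_le)
    also have "\<dots> = - z * ((-1) ^ a * z ^ (a - k))" unfolding sign[OF k] ..
    finally have *: "(-1) ^ k * (- z) ^ (1 + a - k) = - z * ((-1) ^ a * z ^ (a - k))" .
    show "well_poised_coeff (- of_nat a) \<beta> k * ((-1) ^ k * (- z) ^ (1 + a - k))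
      = - z * (well_poised_coeff (- of_nat a) \<beta> (a - k) * z ^ (a - k))"
      unfolding * using k by (simp add: well_poised_coeff_neg_symmetric nz_n)
  qed
  also have "\<dots> = - z * P a"
    unfolding P_def sum_distrib_left
    by (rule sum.reindex_bij_witness[of _ "\<lambda>k. a - k" "\<lambda>k. a - k"]) auto
  also have "(\<Sum>k\<le>a. well_poised_coeff (- of_nat a) \<beta> k * z ^ k) + - z * P a = (1 - z) * P a"
    by (simp add: P_def algebra_simps)
  also have "\<dots> = (1 - z) ^ (1 + a) * (\<Sum>k | 2 * k \<le> a. quadratic_coeff (- of_nat a) \<beta> k *
      (- z / (1 - z) ^ 2) ^ k)"
    by (simp add: P)
  \<comment> \<open>The added coefficients, with 2k > a, contain the factor \<alpha> + a =
    0.\<close>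
  also have "(\<Sum>k | 2 * k \<le> a. quadratic_coeff (- of_nat a) \<beta> k * (- z / (1 - z) ^ 2) ^ k)
    = (\<Sum>k | 2 * k \<le> a + CARD('p). quadratic_coeff (- of_nat a) \<beta> k * (- z / (1 - z) ^ 2) ^ k)"
  proof (rule sum.mono_neutral_left)
    show "finite {k. 2 * k \<le> a + CARD('p)}"
      by (rule finite_subset[of _ "{..a + CARD('p)}"]) auto
  qed (auto simp: quadratic_coeff_def pochhammer_of_nat_eq_0_iff)
  finally show "F 0 = G 0" unfolding G_def by simp

  \<comment> \<open>At s = -1 the correction 1 + (w^(p - 1) - 1) is exactly w^(p - 1), so the
    exponent becomes a + p = n, equal to the degree. The reflected sum is then the part k >= p of
    the polynomial.\<close>
  define n where "n = a + CARD('p)"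
  have arg: "- of_nat a + of_nat CARD('p) * (- 1) = (- of_nat n :: 'p padic)" by (simp add: n_def)
  have "F (- 1) = (\<Sum>k\<le>a. well_poised_coeff (- of_nat n) \<beta> k * z ^ k)
      + (\<Sum>k\<le>a. well_poised_coeff (- of_nat n) \<beta> (n - k) * z ^ (n - k))"
    unfolding F_def arg sum.distrib[symmetric]
  proof (intro sum.cong refl)
    fix k assume "k \<in> {..a}"
    then have k: "k \<le> a" "k \<le> n" by (simp_all add: n_def)
    have "1 + a - k + (CARD('p) - 1) = n - k" using k b_less by (simp add: n_def)
    then have "(-1) ^ k * (- z) ^ (1 + a - k) * (1 + - (- 1) * ((- z) ^ (CARD('p) - 1) - 1))
      = (-1) ^ k * (- z) ^ (n - k)"
      by (simp add: mult.assoc flip: power_add)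
    also have "\<dots> = (-1) ^ n * z ^ (n - k)" by (rule sign) fact
    finally have *: "(-1) ^ k * (- z) ^ (1 + a - k) * (1 + - (- 1) * ((- z) ^ (CARD('p) - 1) - 1))
      = (-1) ^ n * z ^ (n - k)" .
    have "well_poised_coeff (- of_nat n) \<beta> (n - k) = (-1) ^ n * well_poised_coeff (- of_nat n) \<beta> k"
      using k by (intro well_poised_coeff_neg_symmetric nz_n) (simp_all add: n_def)
    then show "well_poised_coeff (- of_nat n) \<beta> k *
        (z ^ k + (-1) ^ k * (- z) ^ (1 + a - k) * (1 + - (- 1) * ((- z) ^ (CARD('p) - 1) - 1)))
      = well_poised_coeff (- of_nat n) \<beta> k * z ^ k + well_poised_coeff (- of_nat n) \<beta> (n - k) * z ^ (n - k)"
      unfolding * by (simp add: algebra_simps)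
  qed
  also have "(\<Sum>k\<le>a. well_poised_coeff (- of_nat n) \<beta> (n - k) * z ^ (n - k))
    = (\<Sum>k\<in>{CARD('p)..n}. well_poised_coeff (- of_nat n) \<beta> k * z ^ k)"
    by (rule sum.reindex_bij_witness[of _ "\<lambda>k. n - k" "\<lambda>k. n - k"]) (auto simp: n_def)
  \<comment> \<open>The summand 0 holds the place of the range a < k < p.\<close>
  finally have F: "F (- 1) = (\<Sum>k\<le>a. well_poised_coeff (- of_nat n) \<beta> k * z ^ k) + 0
    + (\<Sum>k\<in>{CARD('p)..n}. well_poised_coeff (- of_nat n) \<beta> k * z ^ k)" by simp
  have z_Int: "z \<in> padic_Ints" using z by (simp add: padic_units_iff)
  have middle: "padic_cong 2 (\<Sum>k\<in>{a<..<CARD('p)}. well_poised_coeff (- of_nat n) \<beta> k * z ^ k)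
    (\<Sum>k\<in>{a<..<CARD('p)}. 0)"
    using nz_n z_Int unfolding n_def
    by (intro padic_cong_sum padic_cong_0_mult_right well_poised_coeff_middle) (auto intro: padic_Ints_power)
  have "padic_cong 2 (F (- 1)) ((\<Sum>k\<le>a. well_poised_coeff (- of_nat n) \<beta> k * z ^ k)
    + (\<Sum>k\<in>{a<..<CARD('p)}. well_poised_coeff (- of_nat n) \<beta> k * z ^ k)
    + (\<Sum>k\<in>{CARD('p)..n}. well_poised_coeff (- of_nat n) \<beta> k * z ^ k))"
    unfolding F using padic_cong_sym[OF middle] by (intro padic_cong_add padic_cong_refl) simp
  also have "\<dots> = P n"
  proof -
    have "{..n} = {..a} \<union> {a<..<CARD('p)} \<union> {CARD('p)..n}"
      using a_le_b b_less by (auto simp: n_def)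
    moreover have "({..a} \<union> {a<..<CARD('p)}) \<inter> {CARD('p)..n} = {}" "{..a} \<inter> {a<..<CARD('p)} = {}"
      using a_le_b b_less by auto
    ultimately show ?thesis unfolding P_def by (simp only: sum.union_disjoint finite_Un finite_atMost
        finite_greaterThanLessThan finite_atLeastAtMost)
  qed
  also have "P n = G (- 1)"
  proof -
    have "(1 - z) ^ (1 + a) * (1 + - (- 1) * ((1 - z) ^ (CARD('p) - 1) - 1))
      = (1 - z) ^ (1 + a + (CARD('p) - 1))" by (simp only: power_add) simp
    also have "1 + a + (CARD('p) - 1) = n" using b_less by (simp add: n_def)
    finally show ?thesis unfolding G_def arg P[of n, unfolded n_def, OF order_refl, folded n_def]
      by (simp add: n_def)
  qed
  finally show "padic_cong 2 (F (- 1)) (G (- 1))" .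
qed

lemma congruence_truncated:
  fixes z s :: "'p padic"
  assumes z: "z \<in> padic_units" and z1: "1 - z \<in> padic_units" and s: "s \<in> padic_Ints"
    and nz: "\<beta> \<noteq> - of_nat b"
  shows "padic_cong 2
    (\<Sum>k\<le>a. well_poised_coeff (- of_nat a + of_nat CARD('p) * s) \<beta> k *
      (z ^ k + (-1) ^ k * (- z) ^ (1 + a - k) * (1 + - s * ((- z) ^ (CARD('p) - 1) - 1))))
    ((1 - z) ^ (1 + a) * (1 + - s * ((1 - z) ^ (CARD('p) - 1) - 1)) *
      (\<Sum>k | 2 * k \<le> a + CARD('p). quadratic_coeff (- of_nat a + of_nat CARD('p) * s) \<beta> k *
        (- z / (1 - z) ^ 2) ^ k))"
    (is "padic_cong 2 (?F s) (?G s)")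
proof (rule padic_affine_cong[of ?F ?G])
  have z_Int: "z \<in> padic_Ints" using z by (simp add: padic_units_iff)
  have "- z \<in> padic_units"
    using z padic_cong_uminus[of 1 "- z" 0] by (auto simp: padic_units_iff intro: padic_Ints_uminus)
  have "1 - z \<in> padic_Ints" "\<not> padic_cong 1 ((1 - z) ^ 2) 0"
    using z1 padic_unit_power by (auto simp: padic_units_iff)
  then have y: "- z / (1 - z) ^ 2 \<in> padic_Ints"
    using z_Int by (intro padic_Ints_divide padic_Ints_intros)
  have range: "k < CARD('p)" "k + b < CARD('p) + a" if "k \<le> a" for k
    using that a_le_b b_less by linarith+
  show "padic_affine ?F"
    by (rule padic_affine_sum, rule padic_affine_mult,
        rule padic_affine_well_poised_coeff, simp_all only: atMost_iff range,
        intro padic_affine_add padic_affine_mult padic_affine_power_correction padic_affine_const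
          padic_Ints_intros z_Int \<open>- z \<in> padic_units\<close>)
  \<comment> \<open>Adding 2k <= a + p and 2b < p + a gives k + b < p + a, so the longer sum on the
    right still has unit denominators.\<close>
  have range': "k < CARD('p)" "k + b < CARD('p) + a" if "2 * k \<le> a + CARD('p)" for k
    using that a_le_b b_less two_b_less by linarith+
  show "padic_affine ?G"
    by (rule padic_affine_mult, rule padic_affine_mult, intro padic_affine_const padic_Ints_intros z_Int,
        rule padic_affine_power_correction[OF z1], rule padic_affine_sum, rule padic_affine_mult,
        rule padic_affine_quadratic_coeff, simp_all only: mem_Collect_eq range',
        intro padic_affine_const padic_Ints_intros y)
  have "z \<noteq> 1" using z1 by (auto simp: padic_units_iff)
  from congruence_interpolation_nodes[OF z this nz]
  show "padic_cong 2 (?F 0) (?G 0)" "padic_cong 2 (?F (- 1)) (?G (- 1))" by simp_all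
qed (rule s)

end

theorem theorem2p13:
  fixes p :: nat and \<alpha> \<beta> z :: "'p::prime_card padic"
  assumes "p = CARD('p)" and "odd p"
    and "\<alpha> \<in> padic_Ints" and "\<beta> \<in> padic_Ints"
    and "z \<in> padic_units" and "\<not> padic_cong 1 (z - 1) 0"
    and "padic_residue (- \<alpha>) \<le> padic_residue (- \<beta>)"
    and "int p + padic_residue (- \<alpha>) > 2 * padic_residue (- \<beta>)"
    and "\<not> padic_cong 2 (pochhammer (\<alpha> - \<beta> + 1) (p - 1)) 0"
  shows "padic_cong 2
    (hypergeom_3F2_trunc \<alpha> \<alpha> \<beta> 1 (\<alpha> - \<beta> + 1) z (p - 1)
      + padic_powr (- z) ((1, 0) - padic_lambda \<alpha>)
        * hypergeom_3F2_trunc \<alpha> \<alpha> \<beta> 1 (\<alpha> - \<beta> + 1) (1 / z) (p - 1))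
    (padic_powr (1 - z) ((1, 0) - padic_lambda \<alpha>)
      * hypergeom_3F2_trunc (1 - \<beta>) (1/2 * \<alpha>) (1/2 * \<alpha> + 1/2) 1 (\<alpha> - \<beta> + 1)
          (- (4 * z / (1 - z) ^ 2)) (p - 1))"
proof -
  note p = assms(1) and \<alpha> = assms(3) and \<beta> = assms(4) and z = assms(5)
  let ?P = "of_nat CARD('p) :: 'p padic"
  have residue: "\<exists>c::nat. padic_residue (- x) = int c \<and> c < CARD('p) \<and> padic_cong 1 x (of_int (- int c))"
    if "x \<in> padic_Ints" for x :: "'p padic"
  proof -
    let ?r = "padic_residue (- x)"
    have r: "0 \<le> ?r \<and> ?r < int CARD('p) \<and> padic_cong 1 (- x) (of_int ?r)"
      unfolding padic_residue_def by (rule theI'[OF padic_residue_ex1]) (intro padic_Ints_intros that)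
    then have "padic_cong 1 x (- of_int ?r)" using padic_cong_uminus[of 1 "- x"] by simp
    with r show ?thesis by (intro exI[of _ "nat ?r"]) auto
  qed
  obtain a where a: "padic_residue (- \<alpha>) = int a" "padic_cong 1 \<alpha> (of_int (- int a))"
    using residue[OF \<alpha>] by blast
  obtain b where b: "padic_residue (- \<beta>) = int b" "b < CARD('p)" "padic_cong 1 \<beta> (of_int (- int b))"
    using residue[OF \<beta>] by blast
  have ab: "a \<le> b" "2 * b < CARD('p) + a" using assms(7,8) unfolding a(1) b(1) p by linarith+
  interpret orig: whipple_residues a b \<beta>
    by unfold_locales (use \<beta> b ab in auto)
  \<comment> \<open>At the node \<open>n = a + p\<close> one divides by \<open>pochhammer \<beta> n\<close>, which is \<open>0\<close> if \<open>\<beta> = -b\<close>.\<close>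
  define \<beta>' where "\<beta>' = (if \<beta> = - of_nat b then \<beta> + ?P ^ 2 else \<beta>)"
  have \<beta>': "\<beta>' \<in> padic_Ints" unfolding \<beta>'_def using \<beta> by (auto intro: padic_Ints_intros)
  have \<beta>'_cong: "padic_cong 2 \<beta> \<beta>'" unfolding \<beta>'_def padic_cong_def
    by (rule bexI[of _ "if \<beta> = - of_nat b then - 1 else 0"]) (auto intro: padic_Ints_intros)
  have \<beta>'_nz: "\<beta>' \<noteq> - of_nat b" unfolding \<beta>'_def by auto
  have "padic_cong 1 \<beta>' (of_int (- int b))"
    using padic_cong_trans[OF padic_cong_mono[OF padic_cong_sym[OF \<beta>'_cong]] b(3)] by simp
  then interpret shifted: whipple_residues a b \<beta>'
    by unfold_locales (use \<beta>' b ab in auto)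

  have z_Int: "z \<in> padic_Ints" using z by (simp add: padic_units_iff)
  then have z0: "z \<noteq> 0" using z by (auto simp: padic_units_iff)
  have "1 / z \<in> padic_Ints" using z by (intro padic_Ints_divide) (simp_all add: padic_units_iff)
  have mz: "- z \<in> padic_units"
    using z padic_cong_uminus[of 1 "- z" 0] by (auto simp: padic_units_iff intro: padic_Ints_uminus)
  have z1: "1 - z \<in> padic_units"
    using z_Int assms(6) padic_cong_uminus[of 1 "1 - z" 0]
    by (auto simp: padic_units_iff intro: padic_Ints_intros)
  have "\<not> padic_cong 1 ((1 - z) ^ 2) 0"
    using z1 padic_unit_power by (auto simp: padic_units_iff)
  then have y: "- z / (1 - z) ^ 2 \<in> padic_Ints"
    using z_Int by (intro padic_Ints_divide padic_Ints_intros)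

  define s where "s = (\<alpha> + of_int (padic_residue (- \<alpha>))) / ?P"
  have "padic_cong 1 (\<alpha> + of_nat a) 0"
    unfolding padic_cong_0_add_of_nat_iff[OF a(2)] by simp
  then obtain t where t: "t \<in> padic_Ints" "\<alpha> + of_nat a = ?P * t"
    unfolding padic_cong_0_iff by auto
  then have "s = t" unfolding s_def a(1) by simp
  then have s: "s \<in> padic_Ints" and \<alpha>_eq: "- of_nat a + ?P * s = \<alpha>"
    using t by (simp_all add: algebra_simps flip: t(2))
  \<comment> \<open>The integer part is 1 - (-a), a natural number as the first-order congruence for
    powers requires; the p-adic part is 0 - s.\<close>
  have exponent: "(1, 0) - padic_lambda \<alpha> = (int (1 + a), - s)"
    unfolding padic_lambda_def s_def by (simp add: a(1))
  define W where "W w = 1 + - s * (w ^ (CARD('p) - 1) - 1)" for w :: "'p padic"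
  have powr: "padic_cong 2 (padic_powr w ((1, 0) - padic_lambda \<alpha>)) (w ^ (1 + a) * W w)"
    if "w \<in> padic_units" for w
    unfolding exponent W_def using that s by (intro padic_powr_cong padic_Ints_uminus)
  have W_Int: "w ^ (1 + a) * W w \<in> padic_Ints" if "w \<in> padic_units" for w
    unfolding W_def using that s by (auto simp: padic_units_iff intro!: padic_Ints_intros)
  note iii = assms(9)[unfolded p]

  have range: "k < CARD('p)" "k + b < CARD('p) + a" if "k \<le> a" for k
    using that ab b(2) by linarith+
  have range': "k < CARD('p)" "k + b < CARD('p) + a" if "2 * k \<le> a + CARD('p)" for k
    using that ab b(2) by linarith+

  have left: "padic_cong 2 (hypergeom_3F2_trunc \<alpha> \<alpha> \<beta> 1 (\<alpha> - \<beta> + 1) x (p - 1))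
      (\<Sum>k\<le>a. well_poised_coeff \<alpha> \<beta>' k * x ^ k)"
    and left_Int: "(\<Sum>k\<le>a. well_poised_coeff \<alpha> \<beta>' k * x ^ k) \<in> padic_Ints"
    if x: "x \<in> padic_Ints" for x
  proof -
    have "padic_cong 2 (hypergeom_3F2_trunc \<alpha> \<alpha> \<beta> 1 (\<alpha> - \<beta> + 1) x (p - 1))
      (\<Sum>k\<le>a. well_poised_coeff \<alpha> \<beta> k * x ^ k)"
      unfolding hypergeom_well_poised p by (rule orig.well_poised_sum_truncate[OF \<alpha> a(2) iii x])
    \<comment> \<open>\<beta> is replaced by \<open>\<beta>'\<close> only after truncation: the
      denominators that remain are units, whereas a discarded one may contain p.\<close>
    also have "padic_cong 2 \<dots> (\<Sum>k\<le>a. well_poised_coeff \<alpha> \<beta>' k * x ^ k)"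
      using range
      by (intro padic_cong_sum padic_cong_mult shifted.padic_cong_well_poised_coeff
          shifted.well_poised_coeff_Ints padic_cong_refl padic_Ints_power \<alpha> a \<beta> \<beta>'_cong x) auto
    finally show "padic_cong 2 (hypergeom_3F2_trunc \<alpha> \<alpha> \<beta> 1 (\<alpha> - \<beta> + 1) x (p - 1))
      (\<Sum>k\<le>a. well_poised_coeff \<alpha> \<beta>' k * x ^ k)" .
    show "(\<Sum>k\<le>a. well_poised_coeff \<alpha> \<beta>' k * x ^ k) \<in> padic_Ints"
      using range
      by (intro padic_Ints_sum padic_Ints_mult shifted.well_poised_coeff_Ints padic_Ints_power \<alpha> a x) auto
  qed
  let ?Q = "\<Sum>k | 2 * k \<le> a + CARD('p). quadratic_coeff \<alpha> \<beta>' k * (- z / (1 - z) ^ 2) ^ k"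
  have right: "padic_cong 2 (hypergeom_3F2_trunc (1 - \<beta>) (1/2 * \<alpha>) (1/2 * \<alpha> + 1/2) 1 (\<alpha> - \<beta> + 1)
      (- (4 * z / (1 - z) ^ 2)) (p - 1)) ?Q"
  proof -
    have "padic_cong 2 (hypergeom_3F2_trunc (1 - \<beta>) (1/2 * \<alpha>) (1/2 * \<alpha> + 1/2) 1 (\<alpha> - \<beta> + 1)
      (- (4 * z / (1 - z) ^ 2)) (p - 1))
      (\<Sum>k | 2 * k \<le> a + CARD('p). quadratic_coeff \<alpha> \<beta> k * (- z / (1 - z) ^ 2) ^ k)"
      unfolding hypergeom_quadratic p by (rule orig.quadratic_sum_truncate[OF \<alpha> a(2) iii y])
    also have "padic_cong 2 \<dots> ?Q"
      using range'
      by (intro padic_cong_sum padic_cong_mult shifted.padic_cong_quadratic_coeff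
          shifted.quadratic_coeff_Ints padic_cong_refl padic_Ints_power \<alpha> a \<beta> \<beta>'_cong y) auto
    finally show ?thesis .
  qed
  have right_Int: "?Q \<in> padic_Ints"
    using range'
    by (intro padic_Ints_sum padic_Ints_mult shifted.quadratic_coeff_Ints padic_Ints_power \<alpha> a y) auto

  have "padic_cong 2
    (hypergeom_3F2_trunc \<alpha> \<alpha> \<beta> 1 (\<alpha> - \<beta> + 1) z (p - 1)
      + padic_powr (- z) ((1, 0) - padic_lambda \<alpha>)
        * hypergeom_3F2_trunc \<alpha> \<alpha> \<beta> 1 (\<alpha> - \<beta> + 1) (1 / z) (p - 1))
    ((\<Sum>k\<le>a. well_poised_coeff \<alpha> \<beta>' k * z ^ k)
      + (- z) ^ (1 + a) * W (- z) * (\<Sum>k\<le>a. well_poised_coeff \<alpha> \<beta>' k * (1 / z) ^ k))"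
    using \<open>1 / z \<in> padic_Ints\<close>
    by (intro padic_cong_add padic_cong_mult left powr mz z_Int W_Int padic_Ints_cong[OF left left_Int])
  also have "\<dots> = (\<Sum>k\<le>a. well_poised_coeff \<alpha> \<beta>' k * (z ^ k + (-1) ^ k * (- z) ^ (1 + a - k) * W (- z)))"
    unfolding sum_distrib_left sum.distrib[symmetric]
  proof (intro sum.cong refl)
    fix k assume "k \<in> {..a}"
    then have "(- z) ^ (1 + a) = (- z) ^ (1 + a - k) * (- z) ^ k" by (simp flip: power_add)
    moreover have "(- z) ^ k * (1 / z) ^ k = (-1) ^ k"
      using z0 by (simp flip: power_mult_distrib)
    ultimately have "(- z) ^ (1 + a) * (1 / z) ^ k = (- z) ^ (1 + a - k) * (-1) ^ k"
      by (simp only: mult.assoc)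
    then have "W (- z) * well_poised_coeff \<alpha> \<beta>' k * ((- z) ^ (1 + a) * (1 / z) ^ k)
      = W (- z) * well_poised_coeff \<alpha> \<beta>' k * ((- z) ^ (1 + a - k) * (-1) ^ k)" by (rule arg_cong)
    then show "well_poised_coeff \<alpha> \<beta>' k * z ^ k
        + (- z) ^ (1 + a) * W (- z) * (well_poised_coeff \<alpha> \<beta>' k * (1 / z) ^ k)
      = well_poised_coeff \<alpha> \<beta>' k * (z ^ k + (-1) ^ k * (- z) ^ (1 + a - k) * W (- z))"
      by (simp only: distrib_left mult_ac)
  qed
  also have "padic_cong 2 \<dots> ((1 - z) ^ (1 + a) * W (1 - z) * ?Q)"
    using shifted.congruence_truncated[OF z z1 s \<beta>'_nz] unfolding W_def \<alpha>_eq .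
  also have "padic_cong 2 \<dots> (padic_powr (1 - z) ((1, 0) - padic_lambda \<alpha>)
      * hypergeom_3F2_trunc (1 - \<beta>) (1/2 * \<alpha>) (1/2 * \<alpha> + 1/2) 1 (\<alpha> - \<beta> + 1)
          (- (4 * z / (1 - z) ^ 2)) (p - 1))"
    by (rule padic_cong_sym)
      (intro padic_cong_mult right powr z1 W_Int padic_Ints_cong[OF right right_Int])
  finally show ?thesis .
qed

end
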